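(* Consider the scalar stationary equation $$(1-|\Phi_{n,m}|^2)\Phi_{n,m}=\epsilon\left(\Phi_{n+1,m}+\Phi_{n-1,m}+\Phi_{n,m+1}+\Phi_{n,m-1}\right),\qquad (n,m)\in\mathbb{Z}^2 .$$ There exists a unique (up to the gauge invariance $\Phi\mapsto e^{i\alpha}\Phi$, $\alpha\in\mathbb{R}$) continuation in $\epsilon$, for small $\epsilon\ge 0$, of the limiting solution at $\epsilon=0$ $$\Phi^{(0)}_{n,m}=\begin{cases} e^{i\theta_j}, & (n,m)\in S^{(0)},\\ 0,& (n,m)\notin S^{(0)},\end{cases}\qquad \theta_j=\frac{\pi(j-1)}{2},\quad j=1,2,3,4,$$ where $S^{(0)}=\{(-1,0);(0,-1);(1,0);(0,1)\}\subset\mathbb{Z}^2$ has its nodes enumerated in this order by $j=1,2,3,4$. The family of vortex solutions $\Phi_{n,m}(\epsilon)$, $(n,m)\in\mathbb{Z}^2$, is a smooth (real analytic) function of $\epsilon$.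
   Context: Solutions are localized complex-valued sequences, $\Phi\in\ell^2(\mathbb{Z}^2,\mathbb{C})$. A continuation in $\epsilon$ of the limiting solution $\Phi^{(0)}$ means a family $\Phi(\epsilon)$ of localized solutions, defined for all sufficiently small $\epsilon\ge 0$, with $\Phi(0)=\Phi^{(0)}$. The parameter $\epsilon$ is a small non-negative coupling constant. *)

theory Defs
  imports "HOL-Analysis.Analysis"
begin

section \<open>The normed space of square-summable complex families\<close>

typedef 'i ell2 = "{x :: 'i \<Rightarrow> complex. (\<lambda>p. (cmod (x p))\<^sup>2) summable_on UNIV}"
  morphisms entry Abs_ell2
  by (rule exI[of _ "\<lambda>_. 0"]) simp

setup_lifting type_definition_ell2

lemma entry_summable: "(\<lambda>p. (cmod (entry x p))\<^sup>2) summable_on UNIV"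
  using entry[of x] by simp

lemma ell2_eqI: "(\<And>p. entry x p = entry y p) \<Longrightarrow> x = y"
  by (simp add: entry_inject[symmetric] fun_eq_iff)

lemma square_summable_add:
  fixes x y :: "'i \<Rightarrow> complex"
  assumes "(\<lambda>p. (cmod (x p))\<^sup>2) summable_on UNIV" "(\<lambda>p. (cmod (y p))\<^sup>2) summable_on UNIV"
  shows "(\<lambda>p. (cmod (x p + y p))\<^sup>2) summable_on UNIV"
proof (rule summable_on_comparison_test)
  show "(\<lambda>p. 2 * (cmod (x p))\<^sup>2 + 2 * (cmod (y p))\<^sup>2) summable_on UNIV"
    by (intro summable_on_add summable_on_cmult_right assms)
  fix p
  have "(cmod (x p + y p))\<^sup>2 \<le> (cmod (x p) + cmod (y p))\<^sup>2"
    by (intro power_mono norm_triangle_ineq) simp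
  also have "\<dots> \<le> 2 * (cmod (x p))\<^sup>2 + 2 * (cmod (y p))\<^sup>2"
    using sum_squares_bound[of "cmod (x p)" "cmod (y p)"] by (simp add: power2_sum)
  finally show "(cmod (x p + y p))\<^sup>2 \<le> 2 * (cmod (x p))\<^sup>2 + 2 * (cmod (y p))\<^sup>2" .
qed simp_all

instantiation ell2 :: (type) real_normed_vector
begin

lift_definition zero_ell2 :: "'i ell2" is "\<lambda>_. 0" by simp

lift_definition plus_ell2 :: "'i ell2 \<Rightarrow> 'i ell2 \<Rightarrow> 'i ell2" is "\<lambda>x y p. x p + y p"
  by (rule square_summable_add)

lift_definition uminus_ell2 :: "'i ell2 \<Rightarrow> 'i ell2" is "\<lambda>x p. - x p" by simp

lift_definition minus_ell2 :: "'i ell2 \<Rightarrow> 'i ell2 \<Rightarrow> 'i ell2" is "\<lambda>x y p. x p - y p"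
  using square_summable_add[of _ "\<lambda>p. - _ p"] by simp

lift_definition scaleR_ell2 :: "real \<Rightarrow> 'i ell2 \<Rightarrow> 'i ell2" is "\<lambda>c x p. c *\<^sub>R x p"
  by (simp add: power_mult_distrib summable_on_cmult_right)

lift_definition norm_ell2 :: "'i ell2 \<Rightarrow> real" is "\<lambda>x. sqrt (\<Sum>\<^sub>\<infinity>p. (cmod (x p))\<^sup>2)" .

definition dist_ell2 :: "'i ell2 \<Rightarrow> 'i ell2 \<Rightarrow> real" where
  "dist_ell2 x y = norm (x - y)"

definition sgn_ell2 :: "'i ell2 \<Rightarrow> 'i ell2" where
  "sgn_ell2 x = inverse (norm x) *\<^sub>R x"

definition uniformity_ell2 :: "('i ell2 \<times> 'i ell2) filter" where
  "uniformity_ell2 = (INF e\<in>{0<..}. principal {(x, y). dist x y < e})"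

definition open_ell2 :: "'i ell2 set \<Rightarrow> bool" where
  "open_ell2 U = (\<forall>x\<in>U. eventually (\<lambda>(x', y). x' = x \<longrightarrow> y \<in> U) uniformity)"

instance
proof
  fix x y z :: "'i ell2" and a b :: real
  show "x + y + z = x + (y + z)" by transfer (simp add: add.assoc)
  show "x + y = y + x" by transfer (simp add: add.commute)
  show "0 + x = x" by transfer simp
  show "- x + x = 0" by transfer simp
  show "x - y = x + - y" by transfer simp
  show "a *\<^sub>R (x + y) = a *\<^sub>R x + a *\<^sub>R y" by transfer (simp add: scaleR_add_right)
  show "(a + b) *\<^sub>R x = a *\<^sub>R x + b *\<^sub>R x" by transfer (simp add: scaleR_add_left)
  show "a *\<^sub>R b *\<^sub>R x = (a * b) *\<^sub>R x" by transfer simp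
  show "1 *\<^sub>R x = x" by transfer simp
  show "dist x y = norm (x - y)" by (rule dist_ell2_def)
  show "sgn x = inverse (norm x) *\<^sub>R x" by (rule sgn_ell2_def)
  show "uniformity = (INF e\<in>{0<..}. principal {(x :: 'i ell2, y). dist x y < e})"
    by (rule uniformity_ell2_def)
  show "open U = (\<forall>x\<in>U. \<forall>\<^sub>F (x', y) in uniformity. x' = x \<longrightarrow> y \<in> U)" for U :: "'i ell2 set"
    by (rule open_ell2_def)
  show "norm x = 0 \<longleftrightarrow> x = 0"
  proof
    assume "norm x = 0"
    then have "(\<Sum>\<^sub>\<infinity>p. (cmod (entry x p))\<^sup>2) = 0" by (simp add: norm_ell2.rep_eq)
    then have "(cmod (entry x p))\<^sup>2 = 0" for p
      by (rule nonneg_infsum_le_0D[OF eq_refl]) (use entry_summable in auto)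
    then show "x = 0" by (intro ell2_eqI) (simp add: zero_ell2.rep_eq)
  qed (simp add: norm_ell2.rep_eq zero_ell2.rep_eq)
  show "norm (a *\<^sub>R x) = \<bar>a\<bar> * norm x"
    by (simp add: norm_ell2.rep_eq scaleR_ell2.rep_eq power_mult_distrib infsum_cmult_right'
        real_sqrt_mult)
  show "norm (x + y) \<le> norm x + norm y"
  proof -
    have L: "L2_set (\<lambda>p. cmod (entry u p)) F \<le> norm u" if "finite F" for F and u :: "'i ell2"
      unfolding L2_set_def norm_ell2.rep_eq
      by (intro real_sqrt_le_mono finite_sum_le_infsum that entry_summable) auto
    have nn: "0 \<le> norm u" for u :: "'i ell2"
      by (simp add: norm_ell2.rep_eq infsum_nonneg)
    have "(\<Sum>\<^sub>\<infinity>p. (cmod (entry (x + y) p))\<^sup>2) \<le> (norm x + norm y)\<^sup>2"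
    proof (rule infsum_le_finite_sums[OF entry_summable])
      fix F :: "'i set" assume F: "finite F"
      have "L2_set (\<lambda>p. cmod (entry (x + y) p)) F
          \<le> L2_set (\<lambda>p. cmod (entry x p) + cmod (entry y p)) F"
        by (rule L2_set_mono) (simp_all add: plus_ell2.rep_eq norm_triangle_ineq)
      also have "\<dots> \<le> L2_set (\<lambda>p. cmod (entry x p)) F + L2_set (\<lambda>p. cmod (entry y p)) F"
        by (rule L2_set_triangle_ineq)
      also have "\<dots> \<le> norm x + norm y" using L[OF F] by (intro add_mono)
      finally show "(\<Sum>p\<in>F. (cmod (entry (x + y) p))\<^sup>2) \<le> (norm x + norm y)\<^sup>2"
        unfolding L2_set_def by (rule sqrt_le_D)
    qed
    then show ?thesis
      using nn[of x] nn[of y] by (simp add: norm_ell2.rep_eq[of "x + y"] real_le_lsqrt)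
  qed
qed

end

section \<open>Real-analytic functions of a real variable with values in a normed space\<close>

text \<open>The centre \<open>a\<close> may be an end point of \<open>A\<close>: the power series then represents \<open>f\<close> on the
  part of its interval of convergence that lies in \<open>A\<close>. The notion is intended for
  nondegenerate intervals \<open>A\<close>; at isolated points of \<open>A\<close> it is vacuous.\<close>

definition real_analytic_on :: "(real \<Rightarrow> 'a::real_normed_vector) \<Rightarrow> real set \<Rightarrow> bool"
    (infixl \<open>real'_analytic'_on\<close> 50) where
  "f real_analytic_on A \<longleftrightarrow>
     (\<forall>a\<in>A. \<exists>r>0. \<exists>c :: nat \<Rightarrow> 'a.
        \<forall>t\<in>A. \<bar>t - a\<bar> < r \<longrightarrow> (\<lambda>k. (t - a) ^ k *\<^sub>R c k) sums f t)"

section \<open>The stationary equation and the vortex on the diamond\<close>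

definition stationary :: "real \<Rightarrow> (int \<times> int) ell2 \<Rightarrow> bool" where
  "stationary \<epsilon> \<Phi> \<longleftrightarrow>
     (\<forall>n m. (1 - complex_of_real ((cmod (entry \<Phi> (n, m)))\<^sup>2)) * entry \<Phi> (n, m) =
        complex_of_real \<epsilon> *
          (entry \<Phi> (n + 1, m) + entry \<Phi> (n - 1, m) + entry \<Phi> (n, m + 1) + entry \<Phi> (n, m - 1)))"

definition \<theta> :: "nat \<Rightarrow> real" where
  "\<theta> j = pi * (real j - 1) / 2"

lift_definition vortex_limit :: "(int \<times> int) ell2" is
  "\<lambda>p. if p = (-1, 0) then cis (\<theta> 1)
       else if p = (0, -1) then cis (\<theta> 2)
       else if p = (1, 0) then cis (\<theta> 3)
       else if p = (0, 1) then cis (\<theta> 4)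
       else 0"
  by (rule finite_nonzero_values_imp_summable_on,
      rule finite_subset[of _ "{(-1, 0), (0, -1), (1, 0), (0, 1)}"]) (auto split: if_splits)

text \<open>A family of solutions need not depend continuously on \<open>\<epsilon>\<close>. The only regularity demanded of
  a continuation is that it converges in \<open>\<ell>\<^sup>2\<close> to the limiting solution as \<open>\<epsilon>\<close> decreases to
  \<open>0\<close>, without which \<open>\<Phi> 0 = \<Phi>\<^sub>0\<close> would say nothing about \<open>\<Phi> \<epsilon>\<close> for \<open>\<epsilon> > 0\<close>.
  The values of \<open>\<Phi>\<close> outside \<open>{0..<\<epsilon>\<^sub>0}\<close> are irrelevant.\<close>

definition is_continuation :: "(int \<times> int) ell2 \<Rightarrow> real \<Rightarrow> (real \<Rightarrow> (int \<times> int) ell2) \<Rightarrow> bool" where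
  "is_continuation \<Phi>\<^sub>0 \<epsilon>\<^sub>0 \<Phi> \<longleftrightarrow>
     0 < \<epsilon>\<^sub>0 \<and> \<Phi> 0 = \<Phi>\<^sub>0 \<and> (\<forall>\<epsilon>\<in>{0..<\<epsilon>\<^sub>0}. stationary \<epsilon> (\<Phi> \<epsilon>)) \<and> (\<Phi> \<longlongrightarrow> \<Phi>\<^sub>0) (at_right 0)"

definition gauge_equivalent :: "'i ell2 \<Rightarrow> 'i ell2 \<Rightarrow> bool" where
  "gauge_equivalent \<Phi> \<Psi> \<longleftrightarrow> (\<exists>\<alpha>::real. \<forall>p. entry \<Psi> p = cis \<alpha> * entry \<Phi> p)"

end

theory Submission
  imports Defs
begin

text \<open>The four phases at the nodes are free at \<open>\<epsilon> = 0\<close>, so the linearization at the limiting vortex has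
  a four-dimensional kernel and no implicit function theorem applies directly. Existence and
  uniqueness are therefore obtained by different arguments.

  \<^emph>\<open>Existence.\<close> Only part of the equation is kept: all of it away from the nodes, and at a node \<open>p\<close>
  with limiting phase \<open>vort p\<close> its component along \<open>vort p\<close>, for unknowns whose value at \<open>p\<close> is a real
  multiple of \<open>vort p\<close> (\<open>proj_solves\<close>). The linearization of this projected problem is invertible:
  it is \<open>1\<close> away from the nodes and \<open>-2\<close> at a node. Its solution is a power series in \<open>\<epsilon>\<close> whose
  coefficients satisfy a recursion, and a scalar majorant bounds their \<open>\<ell>\<^sup>2\<close> norms geometrically
  (\<open>coef_majorant\<close>); this gives analyticity. The projected problem has at most one solution near the
  vortex (\<open>proj_solves_unique\<close>), so the solution inherits the symmetries of the vortex, reflection in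
  either axis combined with complex conjugation up to sign. These force the neighbour sum at a node to be
  parallel to \<open>vort p\<close>, and the discarded component of the equation holds as well
  (\<open>vortex_solves\<close>).

  \<^emph>\<open>Uniqueness.\<close> It suffices to show that any solution \<open>f\<close> near the vortex has, after a gauge rotation
  making \<open>f (-1, 0)\<close> real, exactly the phases of \<open>vort\<close> at the nodes: then it solves the projected problem
  and equals the constructed one. For \<open>\<epsilon> \<noteq> 0\<close> the equation implies the conservation law
  \<open>Im (cnj (f p) * nbr_sum f p) = 0\<close>, and the phases are determined by it in two steps, at different
  orders in \<open>\<epsilon>\<close>.

  Opposite nodes are coupled at order \<open>\<epsilon>\<^sup>2\<close> in the energy. Comparing \<open>f\<close> with its image under
  \<open>p \<mapsto> -p\<close>, \<open>f \<mapsto> -f\<close> and expanding the conservation law to leading order shows that the two coincide, so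
  \<open>f\<close> is odd (\<open>solution_odd\<close>).

  Among odd solutions the relative phase of the two pairs of opposite nodes remains. The linear
  part of the equation does not couple the two pairs, at any order, because they have different parity
  under \<open>(n, m) \<mapsto> (n, -m)\<close>. The coupling comes from the cubic term at the corners \<open>(\<plusminus>1, \<plusminus>1)\<close>, where both
  pairs have amplitude of order \<open>\<epsilon>\<close>: if \<open>B\<close> is the phase of \<open>f (0, -1)\<close>, the current out of
  \<open>(-1, 0)\<close> is \<open>2 \<epsilon>\<^sup>3 Im (B\<^sup>2)\<close> up to a factor close to \<open>1\<close>. So \<open>B\<^sup>2\<close> is real and \<open>B = \<i>\<close>
  (\<open>solution_quadrature\<close>).\<close>

section \<open>Completeness of \<open>\<ell>\<^sup>2\<close>\<close>

lemma sum_sq_le_norm: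
  assumes "finite F" shows "(\<Sum>p\<in>F. (cmod (entry x p))\<^sup>2) \<le> (norm x)\<^sup>2"
proof -
  have "(\<Sum>p\<in>F. (cmod (entry x p))\<^sup>2) \<le> (\<Sum>\<^sub>\<infinity>p. (cmod (entry x p))\<^sup>2)"
    by (intro finite_sum_le_infsum entry_summable assms) auto
  also have "\<dots> = (norm x)\<^sup>2"
    by (simp add: norm_ell2.rep_eq infsum_nonneg)
  finally show ?thesis .
qed

lemma norm_entry_le: "cmod (entry x p) \<le> norm x"
  using sum_sq_le_norm[of "{p}" x] by (simp add: abs_le_square_iff[symmetric])

text \<open>The way to exhibit elements of \<open>\<ell>\<^sup>2\<close>: membership and norm are both read off from finite
  partial sums.\<close>

lemma ell2_of_bounded_sums:
  fixes f :: "'i \<Rightarrow> complex"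
  assumes "0 \<le> C" "\<And>F. finite F \<Longrightarrow> (\<Sum>p\<in>F. (cmod (f p))\<^sup>2) \<le> C\<^sup>2"
  obtains x where "entry x = f" "norm x \<le> C"
proof -
  have s: "(\<lambda>p. (cmod (f p))\<^sup>2) summable_on UNIV"
    by (intro nonneg_bdd_above_summable_on bdd_aboveI2[of _ _ "C\<^sup>2"]) (use assms in auto)
  define x where "x = Abs_ell2 f"
  have e: "entry x = f" unfolding x_def using s by (simp add: Abs_ell2_inverse)
  have "(\<Sum>\<^sub>\<infinity>p. (cmod (entry x p))\<^sup>2) \<le> C\<^sup>2"
    by (rule infsum_le_finite_sums[OF entry_summable]) (use assms e in auto)
  then have "norm x \<le> C" using \<open>0 \<le> C\<close> by (simp add: norm_ell2.rep_eq real_le_lsqrt infsum_nonneg)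
  with e that show ?thesis by blast
qed

text \<open>A Cauchy sequence converges entrywise, and letting one of the two indices tend to infinity in the finite
  partial sums of the distance bounds the distance to the entrywise limit.\<close>

instance ell2 :: (type) banach
proof
  fix X :: "nat \<Rightarrow> 'a ell2" assume X: "Cauchy X"
  have "Cauchy (\<lambda>n. entry (X n) p)" for p
  proof (rule metric_CauchyI)
    fix e :: real assume "0 < e"
    then obtain N where N: "\<forall>m\<ge>N. \<forall>n\<ge>N. dist (X m) (X n) < e" using X by (auto simp: Cauchy_def)
    show "\<exists>M. \<forall>m\<ge>M. \<forall>n\<ge>M. dist (entry (X m) p) (entry (X n) p) < e"
    proof (intro exI allI impI)
      fix m n assume "N \<le> m" "N \<le> n"
      then have "norm (X m - X n) < e" using N by (simp add: dist_norm)
      then show "dist (entry (X m) p) (entry (X n) p) < e"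
        using norm_entry_le[of "X m - X n" p] by (simp add: dist_norm minus_ell2.rep_eq)
    qed
  qed
  then have "\<exists>y. (\<lambda>n. entry (X n) p) \<longlonglongrightarrow> y" for p
    using Cauchy_convergent_iff convergent_def by blast
  then obtain f where f: "\<And>p. (\<lambda>n. entry (X n) p) \<longlonglongrightarrow> f p" by metis
  have close: "\<exists>y. entry y = (\<lambda>p. entry (X n) p - f p) \<and> norm y \<le> e"
    if N: "\<forall>m\<ge>N. \<forall>n\<ge>N. dist (X m) (X n) < e" and n: "N \<le> n" and e: "0 < e" for e N n
  proof -
    have "(\<Sum>p\<in>F. (cmod (entry (X n) p - f p))\<^sup>2) \<le> e\<^sup>2" if "finite F" for F
    proof (rule LIMSEQ_le_const2)
      show "(\<lambda>m. \<Sum>p\<in>F. (cmod (entry (X n) p - entry (X m) p))\<^sup>2)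
          \<longlonglongrightarrow> (\<Sum>p\<in>F. (cmod (entry (X n) p - f p))\<^sup>2)"
        by (intro tendsto_intros f)
      show "\<exists>M. \<forall>m\<ge>M. (\<Sum>p\<in>F. (cmod (entry (X n) p - entry (X m) p))\<^sup>2) \<le> e\<^sup>2"
      proof (intro exI allI impI)
        fix m assume "N \<le> m"
        then have "(norm (X n - X m))\<^sup>2 \<le> e\<^sup>2"
          using N n by (intro power_mono) (auto simp: dist_norm less_imp_le)
        then show "(\<Sum>p\<in>F. (cmod (entry (X n) p - entry (X m) p))\<^sup>2) \<le> e\<^sup>2"
          using sum_sq_le_norm[OF that, of "X n - X m"] by (simp add: minus_ell2.rep_eq)
      qed
    qed
    then show ?thesis using ell2_of_bounded_sums[of e] e by (metis less_imp_le)
  qed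
  obtain N where "\<forall>m\<ge>N. \<forall>n\<ge>N. dist (X m) (X n) < 1" using X unfolding Cauchy_def by (meson zero_less_one)
  then obtain y where y: "entry y = (\<lambda>p. entry (X N) p - f p)" using close[of N 1 N] by auto
  define x where "x = X N - y"
  have x: "entry x = f" by (simp add: x_def minus_ell2.rep_eq y fun_eq_iff)
  have "X \<longlonglongrightarrow> x"
  proof (rule metric_LIMSEQ_I)
    fix e :: real assume e: "0 < e"
    then obtain N where N: "\<forall>m\<ge>N. \<forall>n\<ge>N. dist (X m) (X n) < e/2"
      using X half_gt_zero[OF e] unfolding Cauchy_def by blast
    show "\<exists>N. \<forall>n\<ge>N. dist (X n) x < e"
    proof (intro exI allI impI)
      fix n assume "N \<le> n"
      then obtain y where y: "entry y = (\<lambda>p. entry (X n) p - f p)" "norm y \<le> e/2"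
        using close[OF N] e by auto
      have "X n - x = y" by (intro ell2_eqI) (simp add: minus_ell2.rep_eq x y)
      then show "dist (X n) x < e" using y e by (simp add: dist_norm)
    qed
  qed
  then show "convergent X" by (auto simp: convergent_def)
qed

lemma ell2_of_dominated:
  assumes "0 \<le> C" "\<And>p. cmod (f p) \<le> C * cmod (entry y p)"
  obtains x where "entry x = f" "norm x \<le> C * norm y"
proof (rule ell2_of_bounded_sums[of "C * norm y" f])
  fix F :: "'a set" assume F: "finite F"
  have "(\<Sum>p\<in>F. (cmod (f p))\<^sup>2) \<le> (\<Sum>p\<in>F. C\<^sup>2 * (cmod (entry y p))\<^sup>2)"
    using power_mono[OF assms(2), of _ 2] by (intro sum_mono) (simp add: power_mult_distrib)
  also have "\<dots> \<le> C\<^sup>2 * (norm y)\<^sup>2"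
    using sum_sq_le_norm[OF F, of y] by (simp add: sum_distrib_left[symmetric] mult_left_mono)
  finally show "(\<Sum>p\<in>F. (cmod (f p))\<^sup>2) \<le> (C * norm y)\<^sup>2" by (simp add: power_mult_distrib)
qed (use assms in auto)

lemma ell2_reindex:
  fixes h :: "'b \<Rightarrow> 'i" and y :: "'i ell2"
  assumes "inj h"
  obtains x where "entry x = (\<lambda>p. entry y (h p))" "norm x \<le> norm y"
proof (rule ell2_of_bounded_sums[of "norm y" "\<lambda>p. entry y (h p)"])
  fix F :: "'b set" assume F: "finite F"
  have "(\<Sum>p\<in>F. (cmod (entry y (h p)))\<^sup>2) = (\<Sum>p\<in>h ` F. (cmod (entry y p))\<^sup>2)"
    using assms by (subst sum.reindex) (auto intro: inj_on_subset)
  also have "\<dots> \<le> (norm y)\<^sup>2" by (intro sum_sq_le_norm) (use F in auto)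
  finally show "(\<Sum>p\<in>F. (cmod (entry y (h p)))\<^sup>2) \<le> (norm y)\<^sup>2" .
qed auto

lemma entry_sum: "entry (sum f A) p = (\<Sum>i\<in>A. entry (f i) p)"
  by (induction A rule: infinite_finite_induct) (auto simp: zero_ell2.rep_eq plus_ell2.rep_eq)

lemma bounded_linear_entry: "bounded_linear (\<lambda>x. entry x p)"
  by (rule bounded_linear_intro[of _ 1])
    (auto simp: plus_ell2.rep_eq scaleR_ell2.rep_eq norm_entry_le)

section \<open>Power series with values in a Banach space\<close>

text \<open>The binomial expansion of \<open>(a + (t - a)) ^ k\<close> turns the series into a double series. It converges
  absolutely because \<open>\<bar>t - a\<bar> + a < R\<close>, so summing over \<open>k\<close> first gives the expansion at \<open>a\<close>.\<close>

lemma power_series_real_analytic: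
  fixes c :: "nat \<Rightarrow> 'a::banach"
  assumes R: "0 < R" and summ: "summable (\<lambda>k. R ^ k * norm (c k))"
  shows "(\<lambda>t. \<Sum>k. t ^ k *\<^sub>R c k) real_analytic_on {0..<R}"
  unfolding real_analytic_on_def
proof (intro ballI)
  fix a assume "a \<in> {0..<R}"
  then have a: "0 \<le> a" "a < R" by auto
  define d where "d j = (\<Sum>\<^sub>\<infinity>k. (real (k choose j) * a ^ (k - j)) *\<^sub>R c k)" for j
  have "(\<lambda>j. (t - a) ^ j *\<^sub>R d j) sums (\<Sum>k. t ^ k *\<^sub>R c k)" if t: "\<bar>t - a\<bar> < R - a" for t
  proof -
    define h where "h = t - a"
    define g where "g k j = (real (k choose j) * a ^ (k - j) * h ^ j) *\<^sub>R c k" for k j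
    have g0: "g k j = 0" if "j \<notin> {..k}" for k j
      using that by (simp add: g_def binomial_eq_0)
    have "(\<Sum>j\<le>k. g k j) = t ^ k *\<^sub>R c k" for k
      unfolding g_def scaleR_sum_left[symmetric] using binomial_ring[of h a k]
      by (simp add: h_def mult_ac)
    then have g_sum: "(g k has_sum t ^ k *\<^sub>R c k) UNIV" for k
      using has_sum_finite_neutralI[of "{..k}" UNIV "g k"] g0 by auto
    have bound: "(\<bar>h\<bar> + a) ^ k \<le> R ^ k" for k
      using t a by (intro power_mono) (auto simp: h_def)
    have "(\<Sum>j\<le>k. norm (g k j)) = (\<bar>h\<bar> + a) ^ k * norm (c k)" for k
      unfolding g_def binomial_ring sum_distrib_right using a
      by (intro sum.cong) (auto simp: abs_mult power_abs)
    then have ng: "((\<lambda>j. norm (g k j)) has_sum (\<bar>h\<bar> + a) ^ k * norm (c k)) UNIV" for k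
      using has_sum_finite_neutralI[of "{..k}" UNIV "\<lambda>j. norm (g k j)"] g0 by auto
    have "(\<lambda>k. (\<bar>h\<bar> + a) ^ k * norm (c k)) summable_on UNIV"
    proof (rule norm_summable_imp_summable_on, rule summable_comparison_test'[OF summ])
      show "norm (norm ((\<bar>h\<bar> + a) ^ k * norm (c k))) \<le> R ^ k * norm (c k)" for k
        using a bound[of k] by (simp add: abs_mult mult_right_mono)
    qed
    then have asg: "(\<lambda>(k, j). g k j) abs_summable_on UNIV \<times> UNIV"
      by (intro summable_on_SigmaI[where g = "\<lambda>k. (\<bar>h\<bar> + a) ^ k * norm (c k)"]) (use ng in auto)
    then have sg: "(\<lambda>(k, j). g k j) summable_on UNIV \<times> UNIV"
      by (rule abs_summable_summable)
    have "(\<lambda>k. t ^ k *\<^sub>R c k) summable_on UNIV"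
      using summable_on_SigmaD[OF sg] g_sum by (simp add: infsumI[OF g_sum] has_sum_imp_summable[OF g_sum])
    then have "((\<lambda>k. t ^ k *\<^sub>R c k) has_sum (\<Sum>k. t ^ k *\<^sub>R c k)) UNIV"
      using has_sum_imp_sums has_sum_infsum sums_unique by metis
    then have "((\<lambda>(k, j). g k j) has_sum (\<Sum>k. t ^ k *\<^sub>R c k)) (UNIV \<times> UNIV)"
      by (intro has_sum_SigmaI[OF _ _ sg]) (use g_sum in auto)
    then have sw: "((\<lambda>(j, k). g k j) has_sum (\<Sum>k. t ^ k *\<^sub>R c k)) (UNIV \<times> UNIV)"
      by (subst (asm) has_sum_swap) simp
    have "((\<lambda>k. g k j) has_sum h ^ j *\<^sub>R d j) UNIV" for j
    proof -
      have "(\<lambda>k. g k j) summable_on UNIV"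
        by (rule abs_summable_summable, rule summable_on_SigmaD1[where A = UNIV and B = "\<lambda>_. UNIV" and x = j and f = "\<lambda>j k. norm (g k j)"])
          (use asg summable_on_swap[of "\<lambda>(j, k). norm (g k j)" UNIV UNIV] in \<open>auto simp: case_prod_unfold\<close>)
      moreover have "(\<Sum>\<^sub>\<infinity>k. g k j) = h ^ j *\<^sub>R d j"
        unfolding d_def g_def infsum_scaleR_right[symmetric] by (simp add: mult_ac)
      ultimately show ?thesis by (metis has_sum_infsum)
    qed
    then have "((\<lambda>j. h ^ j *\<^sub>R d j) has_sum (\<Sum>k. t ^ k *\<^sub>R c k)) UNIV"
      by (intro has_sum_SigmaD[OF sw]) auto
    then show ?thesis unfolding h_def by (rule has_sum_imp_sums)
  qed
  with a show "\<exists>r>0. \<exists>c'. \<forall>t\<in>{0..<R}. \<bar>t - a\<bar> < r \<longrightarrow> (\<lambda>k. (t - a) ^ k *\<^sub>R c' k) sums (\<Sum>k. t ^ k *\<^sub>R c k)"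
    by (intro exI[of _ "R - a"] exI[of _ d]) auto
qed

lemma real_analytic_on_subset:
  assumes "f real_analytic_on A" "B \<subseteq> A" shows "f real_analytic_on B"
  unfolding real_analytic_on_def
proof
  fix a assume "a \<in> B"
  then obtain r c where "0 < r" "\<forall>t\<in>A. \<bar>t - a\<bar> < r \<longrightarrow> (\<lambda>k. (t - a) ^ k *\<^sub>R c k) sums f t"
    using assms unfolding real_analytic_on_def by blast
  then show "\<exists>r>0. \<exists>c. \<forall>t\<in>B. \<bar>t - a\<bar> < r \<longrightarrow> (\<lambda>k. (t - a) ^ k *\<^sub>R c k) sums f t"
    using assms(2) by blast
qed

section \<open>The projected problem\<close>

definition nbr_sum :: "(int \<times> int \<Rightarrow> complex) \<Rightarrow> int \<times> int \<Rightarrow> complex" where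
  "nbr_sum f = (\<lambda>(n, m). f (n + 1, m) + f (n - 1, m) + f (n, m + 1) + f (n, m - 1))"

definition solves :: "real \<Rightarrow> (int \<times> int \<Rightarrow> complex) \<Rightarrow> bool" where
  "solves \<epsilon> f \<longleftrightarrow> (\<forall>p. (1 - complex_of_real ((cmod (f p))\<^sup>2)) * f p = complex_of_real \<epsilon> * nbr_sum f p)"

lemma stationary_iff_solves: "stationary \<epsilon> \<Phi> \<longleftrightarrow> solves \<epsilon> (entry \<Phi>)"
  by (simp add: stationary_def solves_def nbr_sum_def)

definition nodes :: "(int \<times> int) set" where
  "nodes = {(-1, 0), (0, -1), (1, 0), (0, 1)}"

definition vort :: "int \<times> int \<Rightarrow> complex" where
  "vort p = (if p = (-1, 0) then 1 else if p = (0, -1) then \<i> else if p = (1, 0) then -1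
     else if p = (0, 1) then - \<i> else 0)"

lemma entry_vortex_limit: "entry vortex_limit = vort"
proof -
  have "cis (\<theta> 1) = 1" "cis (\<theta> 2) = \<i>" "cis (\<theta> 3) = -1" "cis (\<theta> 4) = - \<i>"
    using cos_3over2_pi sin_3over2_pi by (simp_all add: \<theta>_def complex_eq_iff mult.commute)
  then show ?thesis by (auto simp: vortex_limit.rep_eq vort_def)
qed

lemma vort_off: "p \<notin> nodes \<Longrightarrow> vort p = 0"
  by (simp add: nodes_def vort_def)

lemma norm_vort: "p \<in> nodes \<Longrightarrow> cmod (vort p) = 1"
  by (auto simp: nodes_def vort_def)

lemma norm_vort_le: "cmod (vort p) \<le> 1"
  by (auto simp: vort_def)

text \<open>At the nodes, phases are frozen to those of \<open>vort\<close> and only the component of the equation along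
  \<open>vort\<close> is imposed. This removes the kernel of the linearization.\<close>

definition proj_solves :: "real \<Rightarrow> (int \<times> int \<Rightarrow> complex) \<Rightarrow> bool" where
  "proj_solves \<epsilon> f \<longleftrightarrow> (\<forall>p.
     if p \<in> nodes then Im (cnj (vort p) * f p) = 0 \<and>
       Re (cnj (vort p) * ((1 - complex_of_real ((cmod (f p))\<^sup>2)) * f p - complex_of_real \<epsilon> * nbr_sum f p)) = 0
     else (1 - complex_of_real ((cmod (f p))\<^sup>2)) * f p = complex_of_real \<epsilon> * nbr_sum f p)"

section \<open>Solving the projected problem by a power series\<close>

definition ell2_nbr_sum :: "(int \<times> int) ell2 \<Rightarrow> (int \<times> int) ell2" where
  "ell2_nbr_sum x = Abs_ell2 (nbr_sum (entry x))"

text \<open>Near \<open>vort\<close> the map \<open>f \<mapsto> (1 - \<bar>f\<bar>\<^sup>2) f\<close> has linear part \<open>1\<close> away from the nodes and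
  \<open>w * vort p \<mapsto> -2 * w * vort p\<close> (\<open>w\<close> real) at a node \<open>p\<close>. This is the inverse of the linear part,
  preceded at the nodes by the projection onto the line through \<open>vort p\<close>.\<close>

definition node_inverse :: "(int \<times> int \<Rightarrow> complex) \<Rightarrow> int \<times> int \<Rightarrow> complex" where
  "node_inverse f p = (if p \<in> nodes then - (Re (cnj (vort p) * f p) / 2) *\<^sub>R vort p else f p)"

definition ell2_node_inverse :: "(int \<times> int) ell2 \<Rightarrow> (int \<times> int) ell2" where
  "ell2_node_inverse x = Abs_ell2 (node_inverse (entry x))"

definition ell2_triple :: "'i ell2 \<Rightarrow> 'i ell2 \<Rightarrow> 'i ell2 \<Rightarrow> 'i ell2" where
  "ell2_triple x y z = Abs_ell2 (\<lambda>p. entry x p * cnj (entry y p) * entry z p)"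

lemma proj_solves_off:
  "proj_solves \<epsilon> f \<Longrightarrow> p \<notin> nodes \<Longrightarrow>
     (1 - complex_of_real ((cmod (f p))\<^sup>2)) * f p = complex_of_real \<epsilon> * nbr_sum f p"
  unfolding proj_solves_def by (drule spec[of _ p]) (simp only: if_False)

lemma proj_solves_node:
  assumes "proj_solves \<epsilon> f" "p \<in> nodes"
  shows "Im (cnj (vort p) * f p) = 0"
    "Re (cnj (vort p) * ((1 - complex_of_real ((cmod (f p))\<^sup>2)) * f p - complex_of_real \<epsilon> * nbr_sum f p)) = 0"
  using assms(1)[unfolded proj_solves_def, rule_format, of p] assms(2) by (simp_all only: if_True)

lemma ell2_nbr_sum: "entry (ell2_nbr_sum x) = nbr_sum (entry x)" "norm (ell2_nbr_sum x) \<le> 4 * norm x"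
proof -
  have inj: "inj (\<lambda>(n, m). (n + 1, m) :: int \<times> int)" "inj (\<lambda>(n, m). (n - 1, m) :: int \<times> int)"
    "inj (\<lambda>(n, m). (n, m + 1) :: int \<times> int)" "inj (\<lambda>(n, m). (n, m - 1) :: int \<times> int)"
    by (auto simp: inj_on_def)
  obtain a where a: "entry a = (\<lambda>p. entry x (case p of (n, m) \<Rightarrow> (n + 1, m)))" "norm a \<le> norm x"
    by (rule ell2_reindex[OF inj(1)])
  obtain b where b: "entry b = (\<lambda>p. entry x (case p of (n, m) \<Rightarrow> (n - 1, m)))" "norm b \<le> norm x"
    by (rule ell2_reindex[OF inj(2)])
  obtain c where c: "entry c = (\<lambda>p. entry x (case p of (n, m) \<Rightarrow> (n, m + 1)))" "norm c \<le> norm x"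
    by (rule ell2_reindex[OF inj(3)])
  obtain d where d: "entry d = (\<lambda>p. entry x (case p of (n, m) \<Rightarrow> (n, m - 1)))" "norm d \<le> norm x"
    by (rule ell2_reindex[OF inj(4)])
  have "entry (a + b + c + d) = nbr_sum (entry x)"
    by (auto simp: nbr_sum_def plus_ell2.rep_eq a b c d fun_eq_iff)
  then have *: "ell2_nbr_sum x = a + b + c + d"
    unfolding ell2_nbr_sum_def by (metis entry_inverse)
  then show "entry (ell2_nbr_sum x) = nbr_sum (entry x)"
    using \<open>entry (a + b + c + d) = nbr_sum (entry x)\<close> by simp
  have "norm (a + b + c + d) \<le> norm a + norm b + norm c + norm d"
    by norm
  then show "norm (ell2_nbr_sum x) \<le> 4 * norm x"
    using a(2) b(2) c(2) d(2) unfolding * by linarith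
qed

lemma node_inverse_le: "cmod (node_inverse f p) \<le> cmod (f p)"
proof (cases "p \<in> nodes")
  case True
  have "\<bar>Re (cnj (vort p) * f p)\<bar> \<le> cmod (f p)"
    using abs_Re_le_cmod[of "cnj (vort p) * f p"] norm_vort[OF True] by (simp add: norm_mult)
  then show ?thesis using True norm_vort[OF True] by (simp add: node_inverse_def)
qed (simp add: node_inverse_def)

lemma ell2_node_inverse:
  "entry (ell2_node_inverse x) = node_inverse (entry x)" "norm (ell2_node_inverse x) \<le> norm x"
proof -
  obtain a where "entry a = node_inverse (entry x)" "norm a \<le> 1 * norm x"
    by (rule ell2_of_dominated[of 1 "node_inverse (entry x)" x]) (auto simp: node_inverse_le)
  then show "entry (ell2_node_inverse x) = node_inverse (entry x)" "norm (ell2_node_inverse x) \<le> norm x"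
    unfolding ell2_node_inverse_def by (metis entry_inverse, metis entry_inverse mult_1)
qed

lemma ell2_triple:
  "entry (ell2_triple x y z) p = entry x p * cnj (entry y p) * entry z p"
  "norm (ell2_triple x y z) \<le> norm x * norm y * norm z"
proof -
  let ?f = "\<lambda>p. entry x p * cnj (entry y p) * entry z p"
  obtain a where "entry a = ?f" "norm a \<le> norm x * norm y * norm z"
    by (rule ell2_of_dominated[of "norm x * norm y" ?f z])
      (auto simp: norm_mult norm_entry_le intro!: mult_mono)
  then show "entry (ell2_triple x y z) p = ?f p" "norm (ell2_triple x y z) \<le> norm x * norm y * norm z"
    unfolding ell2_triple_def by (metis entry_inverse, metis entry_inverse)
qed

text \<open>Comparing coefficients of \<open>\<epsilon> ^ Suc n\<close> in the projected problem. The triples with an entry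
  \<open>Suc n\<close> are missing from the sum because they are the linear part of the cubic term, which is moved
  to the other side and inverted.\<close>

function vortex_coef :: "nat \<Rightarrow> (int \<times> int) ell2" where
  "vortex_coef 0 = vortex_limit"
| "vortex_coef (Suc n) = ell2_node_inverse (ell2_nbr_sum (vortex_coef n) +
     (\<Sum>(i, j, k)\<in>{(i, j, k). i + j + k = Suc n \<and> i \<le> n \<and> j \<le> n \<and> k \<le> n}.
        ell2_triple (vortex_coef i) (vortex_coef j) (vortex_coef k)))"
  by pat_completeness auto
termination by lexicographic_order

lemma finite_triples: "finite {(i, j, k). i + j + k = (n :: nat) \<and> Q i j k}"
  by (rule finite_subset[of _ "{..n} \<times> {..n} \<times> {..n}"]) auto

lemma norm_coef_Suc:
  "norm (vortex_coef (Suc n)) \<le> 4 * norm (vortex_coef n) +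
     (\<Sum>(i, j, k)\<in>{(i, j, k). i + j + k = Suc n \<and> i \<le> n \<and> j \<le> n \<and> k \<le> n}.
        norm (vortex_coef i) * norm (vortex_coef j) * norm (vortex_coef k))"
  unfolding vortex_coef.simps
  by (rule order_trans[OF ell2_node_inverse(2)], rule order_trans[OF norm_triangle_ineq],
      intro add_mono ell2_nbr_sum(2) order_trans[OF norm_sum] sum_mono)
    (auto simp: ell2_triple(2))

lemma norm_vortex_limit: "norm vortex_limit \<le> 2"
proof -
  have "((\<lambda>p. (cmod (vort p))\<^sup>2) has_sum (\<Sum>p\<in>nodes. (cmod (vort p))\<^sup>2)) UNIV"
    by (rule has_sum_finite_neutralI[of nodes]) (auto simp: nodes_def vort_def)
  moreover have "(\<Sum>p\<in>nodes. (cmod (vort p))\<^sup>2) = 4"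
    by (simp add: nodes_def vort_def)
  ultimately show ?thesis
    by (simp add: norm_ell2.rep_eq entry_vortex_limit infsumI)
qed

text \<open>With \<open>A\<close> the sum over \<open>1..N\<close>, every triple in the recursion has two indices in \<open>1..N\<close>: if two
  indices vanished, the third would be \<open>Suc n\<close>. Hence the next sum is at most
  \<open>4 r (a 0 + A) + 3 A\<^sup>2 (a 0 + A)\<close>. There is no term linear in \<open>A\<close> without the factor \<open>r\<close>, so the bound
  \<open>1/20\<close> is reproduced when \<open>r\<close> is small.\<close>

lemma cubic_majorant:
  fixes a :: "nat \<Rightarrow> real"
  assumes nn: "\<And>n. 0 \<le> a n" and a0: "a 0 \<le> 2"
    and r: "0 \<le> r" "r \<le> 1/1000"
    and step: "\<And>n. a (Suc n) \<le> 4 * r * a n +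
     (\<Sum>(i, j, k)\<in>{(i, j, k). i + j + k = Suc n \<and> i \<le> n \<and> j \<le> n \<and> k \<le> n}. a i * a j * a k)"
  shows "(\<Sum>n=1..N. a n) \<le> 1/20"
proof (induction N)
  case (Suc N)
  define A where "A = (\<Sum>n=1..N. a n)"
  have A: "0 \<le> A" "A \<le> 1/20" using Suc nn by (auto simp: A_def sum_nonneg)
  have A': "(\<Sum>n\<le>N. a n) = a 0 + A"
    unfolding A_def atMost_atLeast0 by (subst sum.atLeast_Suc_atMost) auto
  define T where "T n = {(i, j, k). i + j + k = Suc n \<and> i \<le> n \<and> j \<le> n \<and> k \<le> n}" for n
  define g where "g = (\<lambda>(i, j, k). a i * a j * a k)"
  have gnn: "0 \<le> g t" for t using nn by (auto simp: g_def split: prod.split)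
  let ?I = "{1..N}" and ?J = "{..N}"
  have fin: "finite (?I \<times> ?I \<times> ?J)" "finite (?I \<times> ?J \<times> ?I)" "finite (?J \<times> ?I \<times> ?I)" by auto
  have sum_Un_le: "sum g (X \<union> Y) \<le> sum g X + sum g Y" if "finite X" "finite Y" for X Y
    using sum.union_inter[OF that, of g] sum_nonneg[of "X \<inter> Y" g] gnn by simp
  have s: "sum g (X \<times> Y \<times> Z) = sum a X * (sum a Y * sum a Z)" for X Y Z
    by (simp add: g_def sum.cartesian_product[symmetric] sum_distrib_left[symmetric] sum_distrib_right[symmetric] mult.assoc)
  have "(\<Sum>n\<le>N. \<Sum>t\<in>T n. g t) = sum g (\<Union>n\<le>N. T n)"
    using finite_triples by (subst sum.UNION_disjoint) (auto simp: T_def)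
  also have "\<dots> \<le> sum g (?I \<times> ?I \<times> ?J \<union> ?I \<times> ?J \<times> ?I \<union> ?J \<times> ?I \<times> ?I)"
    by (rule sum_mono2) (use gnn in \<open>auto simp: T_def\<close>)
  also have "\<dots> \<le> sum g (?I \<times> ?I \<times> ?J) + sum g (?I \<times> ?J \<times> ?I) + sum g (?J \<times> ?I \<times> ?I)"
    using sum_Un_le[of "?I \<times> ?I \<times> ?J \<union> ?I \<times> ?J \<times> ?I" "?J \<times> ?I \<times> ?I"]
      sum_Un_le[of "?I \<times> ?I \<times> ?J" "?I \<times> ?J \<times> ?I"] by auto
  also have "\<dots> = 3 * A * A * (a 0 + A)"
    unfolding s A' A_def[symmetric] by (simp add: algebra_simps)
  also have "\<dots> \<le> 3 * (1/20) * (1/20) * (2 + 1/20)"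
    using A a0 nn by (intro mult_mono add_mono) auto
  finally have cubic: "(\<Sum>n\<le>N. \<Sum>t\<in>T n. g t) \<le> 2/100" by simp
  have "(\<Sum>n=1..Suc N. a n) = (\<Sum>n\<le>N. a (Suc n))"
    using sum.atLeast_Suc_atMost_Suc_shift[of a 0 N] by (simp add: atMost_atLeast0 del: sum.cl_ivl_Suc)
  also have "\<dots> \<le> (\<Sum>n\<le>N. 4 * r * a n + (\<Sum>t\<in>T n. g t))"
    unfolding T_def g_def by (intro sum_mono step)
  also have "\<dots> \<le> 4 * r * (a 0 + A) + 2/100"
    using cubic by (simp add: sum.distrib sum_distrib_left[symmetric] A')
  also have "\<dots> \<le> 4 * (1/1000) * (2 + 1/20) + 2/100"
    using A a0 r nn by (intro add_mono mult_mono) auto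
  finally show ?case by simp
qed simp

lemma coef_majorant: "(\<Sum>n=1..N. (1/1000) ^ n * norm (vortex_coef n)) \<le> 1/20"
proof (rule cubic_majorant)
  fix n
  let ?T = "{(i, j, k). i + j + k = Suc n \<and> i \<le> n \<and> j \<le> n \<and> k \<le> n}"
  have "(1/1000) ^ Suc n * norm (vortex_coef (Suc n)) \<le> (1/1000) ^ Suc n * (4 * norm (vortex_coef n) +
      (\<Sum>(i, j, k)\<in>?T. norm (vortex_coef i) * norm (vortex_coef j) * norm (vortex_coef k)))"
    by (intro mult_left_mono norm_coef_Suc) auto
  also have "\<dots> = 4 * (1/1000) * ((1/1000) ^ n * norm (vortex_coef n)) +
      (\<Sum>(i, j, k)\<in>?T. (1/1000) ^ Suc n * (norm (vortex_coef i) * norm (vortex_coef j) * norm (vortex_coef k)))"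
    by (simp add: algebra_simps sum_distrib_left case_prod_unfold)
  also have "(\<Sum>(i, j, k)\<in>?T. (1/1000) ^ Suc n * (norm (vortex_coef i) * norm (vortex_coef j) * norm (vortex_coef k))) =
     (\<Sum>(i, j, k)\<in>?T. ((1/1000) ^ i * norm (vortex_coef i)) * ((1/1000) ^ j * norm (vortex_coef j)) *
        ((1/1000) ^ k * norm (vortex_coef k)))"
  proof (intro sum.cong refl, clarify)
    fix i j k assume "i + j + k = Suc n"
    then have "(1/1000 :: real) ^ Suc n = (1/1000) ^ i * (1/1000) ^ j * (1/1000) ^ k"
      by (simp only: power_add[symmetric])
    then show "(1/1000) ^ Suc n * (norm (vortex_coef i) * norm (vortex_coef j) * norm (vortex_coef k)) =
      (1/1000) ^ i * norm (vortex_coef i) * ((1/1000) ^ j * norm (vortex_coef j)) * ((1/1000) ^ k * norm (vortex_coef k))"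
      by (simp only: mult_ac)
  qed
  finally show "(1/1000) ^ Suc n * norm (vortex_coef (Suc n)) \<le> 4 * (1/1000) * ((1/1000) ^ n * norm (vortex_coef n)) + \<dots>" .
qed (use norm_vortex_limit in auto)

lemma summable_coef: "summable (\<lambda>n. (1/1000) ^ n * norm (vortex_coef n))"
proof -
  have "summable (\<lambda>n. (1/1000) ^ Suc n * norm (vortex_coef (Suc n)))"
  proof (rule summableI_nonneg_bounded)
    fix N
    have "(\<Sum>n<N. (1/1000) ^ Suc n * norm (vortex_coef (Suc n))) = (\<Sum>n=1..N. (1/1000) ^ n * norm (vortex_coef n))"
      using sum.atLeast1_atMost_eq[of "\<lambda>n. (1/1000) ^ n * norm (vortex_coef n)" N] by simp
    then show "(\<Sum>n<N. (1/1000) ^ Suc n * norm (vortex_coef (Suc n))) \<le> 1/20" using coef_majorant by simp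
  qed auto
  then show ?thesis by (subst (asm) summable_Suc_iff)
qed

lemma triple_Cauchy_product_sums:
  fixes a b c :: "nat \<Rightarrow> complex"
  assumes "summable (\<lambda>n. norm (a n))" "summable (\<lambda>n. norm (b n))" "summable (\<lambda>n. norm (c n))"
  shows "(\<lambda>n. \<Sum>(i, j, k)\<in>{(i, j, k). i + j + k = n}. a i * b j * c k) sums (suminf a * suminf b * suminf c)"
proof -
  let ?d = "\<lambda>n. \<Sum>i\<le>n. a i * b (n - i)"
  have d: "?d sums (suminf a * suminf b)" by (rule Cauchy_product_sums[OF assms(1,2)])
  have "summable (\<lambda>n. norm (?d n))"
  proof (rule summable_comparison_test')
    show "summable (\<lambda>n. \<Sum>i\<le>n. norm (a i) * norm (b (n - i)))"
      using summable_Cauchy_product[of "\<lambda>n. norm (a n)" "\<lambda>n. norm (b n)"] assms by simp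
    show "norm (norm (?d n)) \<le> (\<Sum>i\<le>n. norm (a i) * norm (b (n - i)))" for n
      by (simp add: norm_mult[symmetric] norm_sum)
  qed
  then have "(\<lambda>n. \<Sum>m\<le>n. ?d m * c (n - m)) sums (suminf ?d * suminf c)"
    by (rule Cauchy_product_sums[OF _ assms(3)])
  moreover have "(\<Sum>m\<le>n. ?d m * c (n - m)) = (\<Sum>(i, j, k)\<in>{(i, j, k). i + j + k = n}. a i * b j * c k)" for n
  proof -
    have "(\<Sum>m\<le>n. ?d m * c (n - m)) = (\<Sum>(m, i)\<in>(SIGMA m:{..n}. {..m}). a i * b (m - i) * c (n - m))"
      by (simp add: sum.Sigma sum_distrib_right)
    also have "\<dots> = (\<Sum>(i, j, k)\<in>{(i, j, k). i + j + k = n}. a i * b j * c k)"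
      by (rule sum.reindex_bij_witness[where j = "\<lambda>(m, i). (i, m - i, n - m)" and i = "\<lambda>(i, j, k). (i + j, i)"]) auto
    finally show ?thesis .
  qed
  ultimately show ?thesis using sums_unique[OF d] by simp
qed

definition vortex :: "real \<Rightarrow> (int \<times> int) ell2" where
  "vortex \<epsilon> = (\<Sum>n. \<epsilon> ^ n *\<^sub>R vortex_coef n)"

lemma vortex_real_analytic: "vortex real_analytic_on {0..<1/1000}"
  using power_series_real_analytic[OF _ summable_coef] by (simp add: vortex_def[abs_def])

lemma summable_coef_le:
  assumes "\<bar>\<epsilon>\<bar> \<le> 1/1000" shows "summable (\<lambda>n. norm (\<epsilon> ^ n *\<^sub>R vortex_coef n))"
  by (rule summable_comparison_test'[OF summable_coef])
    (use assms in \<open>auto simp: power_abs intro!: mult_right_mono power_mono\<close>)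

lemma vortex_0: "vortex 0 = vortex_limit"
  unfolding vortex_def 
  by (subst suminf_finite[of "{0}"]) auto

lemma vortex_near:
  assumes "0 \<le> \<epsilon>" "\<epsilon> \<le> 1/1000" shows "norm (vortex \<epsilon> - vortex_limit) \<le> 50 * \<epsilon>"
proof -
  have sm: "summable (\<lambda>n. norm (\<epsilon> ^ n *\<^sub>R vortex_coef n))"
    by (rule summable_coef_le) (use assms in auto)
  then have s: "summable (\<lambda>n. norm (\<epsilon> ^ Suc n *\<^sub>R vortex_coef (Suc n)))"
    by (rule summable_Suc_iff[THEN iffD2])
  have "vortex \<epsilon> = (\<Sum>n. \<epsilon> ^ Suc n *\<^sub>R vortex_coef (Suc n)) + vortex_limit"
    unfolding vortex_def using suminf_split_head[OF summable_norm_cancel[OF sm]] by simp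
  then have "norm (vortex \<epsilon> - vortex_limit) = norm (\<Sum>n. \<epsilon> ^ Suc n *\<^sub>R vortex_coef (Suc n))" by simp
  also have "\<dots> \<le> (\<Sum>n. norm (\<epsilon> ^ Suc n *\<^sub>R vortex_coef (Suc n)))" by (rule summable_norm[OF s])
  also have "\<dots> \<le> 50 * \<epsilon>"
  proof (rule suminf_le_const[OF s])
    fix N
    have "(\<Sum>n<N. norm (\<epsilon> ^ Suc n *\<^sub>R vortex_coef (Suc n))) \<le> (\<Sum>n<N. 1000 * \<epsilon> * ((1/1000) ^ Suc n * norm (vortex_coef (Suc n))))"
    proof (rule sum_mono)
      fix n
      have "\<epsilon> ^ Suc n \<le> \<epsilon> * (1/1000) ^ n" using assms by (auto intro!: mult_left_mono power_mono)
      then have "\<epsilon> ^ Suc n * norm (vortex_coef (Suc n)) \<le> \<epsilon> * (1/1000) ^ n * norm (vortex_coef (Suc n))"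
        by (rule mult_right_mono) auto
      then show "norm (\<epsilon> ^ Suc n *\<^sub>R vortex_coef (Suc n)) \<le> 1000 * \<epsilon> * ((1/1000) ^ Suc n * norm (vortex_coef (Suc n)))"
        using assms by simp
    qed
    also have "\<dots> = 1000 * \<epsilon> * (\<Sum>n=1..N. (1/1000) ^ n * norm (vortex_coef n))"
      using sum.atLeast1_atMost_eq[of "\<lambda>n. (1/1000) ^ n * norm (vortex_coef n)" N] by (simp add: sum_distrib_left)
    also have "\<dots> \<le> 1000 * \<epsilon> * (1/20)" by (intro mult_left_mono coef_majorant) (use assms in auto)
    finally show "(\<Sum>n<N. norm (\<epsilon> ^ Suc n *\<^sub>R vortex_coef (Suc n))) \<le> 50 * \<epsilon>" by simp
  qed
  finally show ?thesis .
qed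

lemma nbr_sum_sums:
  assumes "\<And>p. (\<lambda>n. F n p) sums f p"
  shows "(\<lambda>n. nbr_sum (F n) p) sums nbr_sum f p"
  unfolding nbr_sum_def by (cases p) (auto intro!: sums_add assms)

text \<open>Both sides of the projected problem are power series in \<open>\<epsilon>\<close>, by the triple Cauchy product for the
  cubic term, and the recursion says that their coefficients agree.\<close>

lemma vortex_proj_solves:
  assumes "0 \<le> \<epsilon>" "\<epsilon> \<le> 1/1000" shows "proj_solves \<epsilon> (entry (vortex \<epsilon>))"
proof -
  define v where "v n = entry (vortex_coef n)" for n
  define V where "V = entry (vortex \<epsilon>)"
  define N where "N n p = (\<Sum>(i, j, k)\<in>{(i, j, k). i + j + k = Suc n \<and> i \<le> n \<and> j \<le> n \<and> k \<le> n}.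
        v i p * cnj (v j p) * v k p)" for n p
  have v0: "v 0 = vort" by (simp add: v_def entry_vortex_limit)
  have vSuc: "v (Suc n) p = node_inverse (\<lambda>p. nbr_sum (v n) p + N n p) p" for n p
  proof -
    have "entry (ell2_nbr_sum (vortex_coef n) +
     (\<Sum>(i, j, k)\<in>{(i, j, k). i + j + k = Suc n \<and> i \<le> n \<and> j \<le> n \<and> k \<le> n}.
        ell2_triple (vortex_coef i) (vortex_coef j) (vortex_coef k))) p = nbr_sum (v n) p + N n p" for p
      by (simp add: v_def N_def plus_ell2.rep_eq ell2_nbr_sum entry_sum ell2_triple case_prod_unfold)
    then show ?thesis by (simp add: v_def ell2_node_inverse node_inverse_def)
  qed
  have sm: "summable (\<lambda>n. norm (\<epsilon> ^ n *\<^sub>R vortex_coef n))"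
    by (rule summable_coef_le) (use assms in auto)
  have V: "(\<lambda>n. \<epsilon> ^ n *\<^sub>R v n p) sums V p" for p
    using bounded_linear.sums[OF bounded_linear_entry summable_sums[OF summable_norm_cancel[OF sm]], of p]
    by (simp add: v_def V_def vortex_def scaleR_ell2.rep_eq)
  have smv: "summable (\<lambda>n. norm (\<epsilon> ^ n *\<^sub>R v n p))" for p
    by (rule summable_comparison_test'[OF sm])
      (use norm_entry_le in \<open>auto simp: v_def intro!: mult_left_mono\<close>)
  define c3 where "c3 n p = (\<Sum>(i, j, k)\<in>{(i, j, k). i + j + k = n}. v i p * cnj (v j p) * v k p)" for n p
  have cubic: "(\<lambda>n. \<epsilon> ^ n *\<^sub>R c3 n p) sums (V p * cnj (V p) * V p)" for p
  proof -
    have c: "(\<lambda>n. \<epsilon> ^ n *\<^sub>R cnj (v n p)) sums cnj (V p)"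
      using V[of p] sums_cnj[of "\<lambda>n. \<epsilon> ^ n *\<^sub>R v n p" "V p"] by simp
    have "summable (\<lambda>n. norm (\<epsilon> ^ n *\<^sub>R cnj (v n p)))" using smv[of p] by simp
    from triple_Cauchy_product_sums[OF smv[of p] this smv[of p]]
    have "(\<lambda>n. \<Sum>(i, j, k)\<in>{(i, j, k). i + j + k = n}.
        (\<epsilon> ^ i *\<^sub>R v i p) * (\<epsilon> ^ j *\<^sub>R cnj (v j p)) * (\<epsilon> ^ k *\<^sub>R v k p)) sums (V p * cnj (V p) * V p)"
      unfolding sums_unique[OF V, symmetric] sums_unique[OF c, symmetric] .
    moreover have "(\<Sum>(i, j, k)\<in>{(i, j, k). i + j + k = n}.
        (\<epsilon> ^ i *\<^sub>R v i p) * (\<epsilon> ^ j *\<^sub>R cnj (v j p)) * (\<epsilon> ^ k *\<^sub>R v k p)) = \<epsilon> ^ n *\<^sub>R c3 n p" for n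
      unfolding c3_def scaleR_sum_right by (intro sum.cong) (auto simp: power_add mult_ac)
    ultimately show ?thesis by simp
  qed
  \<comment> \<open>The triples containing \<open>Suc n\<close> are split off; they form the linear part of the cubic term.\<close>
  have c3_Suc: "c3 (Suc n) p = N n p + 2 * (v (Suc n) p * cnj (v 0 p) * v 0 p) + v 0 p * cnj (v (Suc n) p) * v 0 p" for n p
  proof -
    have eq: "{(i, j, k). i + j + k = Suc n} = insert (Suc n, 0, 0) (insert (0, Suc n, 0) (insert (0, 0, Suc n)
       {(i, j, k). i + j + k = Suc n \<and> i \<le> n \<and> j \<le> n \<and> k \<le> n}))" by auto
    show ?thesis unfolding c3_def eq N_def
      using finite_triples[of "Suc n" "\<lambda>i j k. i \<le> n \<and> j \<le> n \<and> k \<le> n"] by (simp add: mult_ac)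
  qed
  have c3_0: "c3 0 p = v 0 p * cnj (v 0 p) * v 0 p" for p
  proof -
    have "{(i, j, k). i + j + k = (0::nat)} = {(0, 0, 0)}" by auto
    then show ?thesis by (simp add: c3_def)
  qed
  have "v 0 p - c3 0 p = 0" for p
    unfolding c3_0 v0 by (auto simp: vort_def)
  moreover have "(\<lambda>n. \<epsilon> ^ n *\<^sub>R (v n p - c3 n p)) sums (V p - V p * cnj (V p) * V p)" for p
    using sums_diff[OF V[of p] cubic[of p]] by (simp add: algebra_simps)
  ultimately have "(\<lambda>n. \<epsilon> ^ Suc n *\<^sub>R (v (Suc n) p - c3 (Suc n) p)) sums (V p - V p * cnj (V p) * V p)" for p
    using sums_Suc_iff[of "\<lambda>n. \<epsilon> ^ n *\<^sub>R (v n p - c3 n p)"] by simp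
  moreover have "V p - V p * cnj (V p) * V p = (1 - complex_of_real ((cmod (V p))\<^sup>2)) * V p" for p
    by (simp only: complex_norm_square) (simp add: algebra_simps)
  ultimately have lhs: "(\<lambda>n. \<epsilon> ^ Suc n *\<^sub>R (v (Suc n) p - c3 (Suc n) p)) sums ((1 - complex_of_real ((cmod (V p))\<^sup>2)) * V p)" for p
    by simp
  have "(\<lambda>n. nbr_sum (\<lambda>q. \<epsilon> ^ n *\<^sub>R v n q) p) sums nbr_sum V p" for p by (rule nbr_sum_sums[OF V])
  moreover have "nbr_sum (\<lambda>q. \<epsilon> ^ n *\<^sub>R v n q) p = \<epsilon> ^ n *\<^sub>R nbr_sum (v n) p" for n p
    by (cases p) (simp add: nbr_sum_def scaleR_add_right)
  ultimately have "(\<lambda>n. \<epsilon> *\<^sub>R (\<epsilon> ^ n *\<^sub>R nbr_sum (v n) p)) sums (\<epsilon> *\<^sub>R nbr_sum V p)" for p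
    by (intro sums_scaleR_right) simp
  then have rhs: "(\<lambda>n. \<epsilon> ^ Suc n *\<^sub>R nbr_sum (v n) p) sums (of_real \<epsilon> * nbr_sum V p)" for p
    by (simp add: scaleR_conv_of_real mult_ac)
  show ?thesis unfolding proj_solves_def V_def[symmetric]
  proof (intro allI)
    fix p
    show "if p \<in> nodes then Im (cnj (vort p) * V p) = 0 \<and>
       Re (cnj (vort p) * ((1 - complex_of_real ((cmod (V p))\<^sup>2)) * V p - complex_of_real \<epsilon> * nbr_sum V p)) = 0
     else (1 - complex_of_real ((cmod (V p))\<^sup>2)) * V p = complex_of_real \<epsilon> * nbr_sum V p"
    proof (cases "p \<in> nodes")
      case False
      have "v (Suc n) p - c3 (Suc n) p = nbr_sum (v n) p" for n
        unfolding c3_Suc using False by (simp add: vSuc v0 vort_off node_inverse_def)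
      then have "(\<lambda>n. \<epsilon> ^ Suc n *\<^sub>R nbr_sum (v n) p) sums ((1 - complex_of_real ((cmod (V p))\<^sup>2)) * V p)"
        using lhs[of p] by (simp only:)
      then show ?thesis using False sums_unique2[OF _ rhs] by (simp only: if_False)
    next
      case True
      have ph: "cnj (vort p) * vort p = 1" using True by (auto simp: nodes_def vort_def)
      have "\<exists>r. v n p = r *\<^sub>R vort p" for n
      proof (cases n)
        case 0 then show ?thesis by (auto simp: v0 intro!: exI[of _ 1])
      next
        case (Suc k) then show ?thesis using True by (auto simp: vSuc node_inverse_def simp del: scaleR_minus_left)
      qed
      then have "Im (cnj (vort p) * v n p) = 0" for n using ph
        by (metis Im_complex_of_real mult.right_neutral mult_scaleR_right scaleR_conv_of_real)
      then have "Im (cnj (vort p) * (\<epsilon> ^ n *\<^sub>R v n p)) = 0" for n by simp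
      then have "(\<lambda>n :: nat. 0) sums Im (cnj (vort p) * V p)"
        using bounded_linear.sums[OF bounded_linear_Im sums_mult[OF V[of p], of "cnj (vort p)"]] by (simp only:)
      then have im: "Im (cnj (vort p) * V p) = 0" by (rule sums_unique2[OF _ sums_zero])
      have "Re (cnj (vort p) * (v (Suc n) p - c3 (Suc n) p)) = Re (cnj (vort p) * nbr_sum (v n) p)" for n
      proof -
        define w where "w = - (Re (cnj (vort p) * (nbr_sum (v n) p + N n p)) / 2)"
        have vw: "v (Suc n) p = w *\<^sub>R vort p" using True by (simp add: vSuc node_inverse_def w_def)
        have "cnj (vort p) * (v (Suc n) p - c3 (Suc n) p) =
           w *\<^sub>R (cnj (vort p) * vort p) - cnj (vort p) * N n p
            - (3 * w) *\<^sub>R ((cnj (vort p) * vort p) * (cnj (vort p) * vort p))"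
          unfolding c3_Suc v0 vw by (simp add: scaleR_conv_of_real algebra_simps)
        then have "Re (cnj (vort p) * (v (Suc n) p - c3 (Suc n) p)) = - 2 * w - Re (cnj (vort p) * N n p)"
          unfolding ph by simp
        moreover have "- 2 * w = Re (cnj (vort p) * nbr_sum (v n) p) + Re (cnj (vort p) * N n p)"
        proof -
          have e: "Re (c * (a + b)) = Re (c * a) + Re (c * b)" for a b c
            by (simp only: distrib_left plus_complex.simps)
          have half: "w = - (z / 2) \<Longrightarrow> z = a + b \<Longrightarrow> - 2 * w = a + b" for a b w z :: real by argo
          show ?thesis by (rule half[OF w_def e])
        qed
        ultimately show ?thesis by (metis add_diff_cancel_right')
      qed
      then have re: "Re (cnj (vort p) * (\<epsilon> ^ Suc n *\<^sub>R (v (Suc n) p - c3 (Suc n) p)))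
          = Re (cnj (vort p) * (\<epsilon> ^ Suc n *\<^sub>R nbr_sum (v n) p))" for n
        by (simp only: mult_scaleR_right scaleR_complex.simps)
      have "(\<lambda>n. Re (cnj (vort p) * (\<epsilon> ^ Suc n *\<^sub>R nbr_sum (v n) p))) sums
          Re (cnj (vort p) * ((1 - complex_of_real ((cmod (V p))\<^sup>2)) * V p))"
        using bounded_linear.sums[OF bounded_linear_Re sums_mult[OF lhs[of p], of "cnj (vort p)"]] by (simp only: re)
      then have "Re (cnj (vort p) * ((1 - complex_of_real ((cmod (V p))\<^sup>2)) * V p)) = Re (cnj (vort p) * (complex_of_real \<epsilon> * nbr_sum V p))"
        using bounded_linear.sums[OF bounded_linear_Re sums_mult[OF rhs[of p], of "cnj (vort p)"]]
        by (rule sums_unique2)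
      then have "Re (cnj (vort p) * ((1 - complex_of_real ((cmod (V p))\<^sup>2)) * V p - complex_of_real \<epsilon> * nbr_sum V p)) = 0"
        by (simp only: right_diff_distrib minus_complex.simps diff_self)
      then show ?thesis using True im by (simp only: if_True simp_thms)
    qed
  qed
qed

section \<open>Uniqueness for the projected problem\<close>

text \<open>Lattice sites are treated as points, so that quantifiers over them should not be split into
  quantifiers over coordinates.\<close>

declare split_paired_All [simp del]

definition near :: "real \<Rightarrow> (int \<times> int \<Rightarrow> complex) \<Rightarrow> bool" where
  "near \<eta> f \<longleftrightarrow> (\<forall>p. cmod (f p - vort p) \<le> \<eta>)"

text \<open>If every bound on a bounded quantity can be halved up to an error \<open>d\<close>, repeated halving leaves only
  the error. Suprema over the lattice are estimated in this way below; with \<open>d = 0\<close> it shows that a difference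
  vanishes.\<close>

lemma self_improving_bound:
  fixes h :: "'a \<Rightarrow> real"
  assumes "\<And>p. h p \<le> M0" and "\<And>M p. (\<And>q. h q \<le> M) \<Longrightarrow> h p \<le> M / 2 + d"
  shows "h p \<le> 2 * d"
proof -
  have bdd: "bdd_above (range h)" using assms(1) by (intro bdd_aboveI2)
  let ?S = "SUP q. h q"
  have le: "h q \<le> ?S" for q by (rule cSUP_upper[OF _ bdd]) simp
  have "?S \<le> ?S / 2 + d" by (rule cSUP_least) (use assms(2)[OF le] in auto)
  then show ?thesis using le[of p] by simp
qed

lemma norm_nbr_sum_le:
  assumes "\<And>q. cmod (f q) \<le> M" shows "cmod (nbr_sum f p) \<le> 4 * M"
proof (cases p)
  case (Pair n m)
  have "cmod (nbr_sum f p) \<le> cmod (f (n + 1, m)) + cmod (f (n - 1, m)) + cmod (f (n, m + 1)) + cmod (f (n, m - 1))"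
    unfolding Pair nbr_sum_def by simp norm
  then show ?thesis using assms[of "(n + 1, m)"] assms[of "(n - 1, m)"] assms[of "(n, m + 1)"] assms[of "(n, m - 1)"]
    by linarith
qed

lemma nbr_sum_diff: "nbr_sum f p - nbr_sum g p = nbr_sum (\<lambda>q. f q - g q) p"
  by (cases p) (simp add: nbr_sum_def)

lemma cubic_diff:
  assumes "cmod z \<le> \<delta>" "cmod w \<le> \<delta>"
  shows "cmod (complex_of_real ((cmod z)\<^sup>2) * z - complex_of_real ((cmod w)\<^sup>2) * w) \<le> 3 * \<delta>\<^sup>2 * cmod (z - w)"
proof -
  have d: "0 \<le> \<delta>" using assms norm_ge_zero order_trans by blast
  have "complex_of_real ((cmod z)\<^sup>2) * z - complex_of_real ((cmod w)\<^sup>2) * w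
     = (z - w) * cnj z * z + w * cnj (z - w) * z + w * cnj w * (z - w)"
    by (simp only: complex_norm_square) (simp add: algebra_simps)
  also have "cmod \<dots> \<le> cmod (z - w) * cmod z * cmod z + cmod w * cmod (z - w) * cmod z + cmod w * cmod w * cmod (z - w)"
    by (intro order_trans[OF norm_triangle_ineq] add_mono) (auto simp: norm_mult simp flip: complex_cnj_diff)
  also have "\<dots> \<le> cmod (z - w) * \<delta> * \<delta> + \<delta> * cmod (z - w) * \<delta> + \<delta> * \<delta> * cmod (z - w)"
    using assms d by (intro add_mono mult_mono) auto
  finally show ?thesis by (simp add: power2_eq_square algebra_simps)
qed

lemma nearD: "near \<eta> f \<Longrightarrow> cmod (f p - vort p) \<le> \<eta>"
  by (simp add: near_def)

lemma near_norm_le: "near \<eta> f \<Longrightarrow> cmod (f p) \<le> 1 + \<eta>"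
  using norm_triangle_ineq2[of "f p" "vort p"] norm_vort_le[of p] nearD[of \<eta> f p] by linarith

lemma near_off: "near \<eta> f \<Longrightarrow> p \<notin> nodes \<Longrightarrow> cmod (f p) \<le> \<eta>"
  using nearD[of \<eta> f p] vort_off[of p] by simp

text \<open>A priori \<open>f\<close> is only known to be small away from the nodes. The equation improves this to the order
  \<open>\<epsilon>\<close>, with constant \<open>5\<close> slightly larger than the four neighbours of size about \<open>1\<close>.\<close>

lemma off_node_bound:
  assumes "near (1/100) f" "0 \<le> \<epsilon>" "p \<notin> nodes"
    and eq: "(1 - complex_of_real ((cmod (f p))\<^sup>2)) * f p = complex_of_real \<epsilon> * nbr_sum f p"
  shows "cmod (f p) \<le> 5 * \<epsilon>"
proof -
  have s: "cmod (f p) \<le> 1/100" using near_off assms by blast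
  then have "(cmod (f p))\<^sup>2 \<le> (1/100)\<^sup>2" by (intro power_mono) auto
  then have "99/100 * cmod (f p) \<le> \<bar>1 - (cmod (f p))\<^sup>2\<bar> * cmod (f p)"
    by (intro mult_right_mono) (auto simp: power2_eq_square)
  also have "\<dots> = cmod (complex_of_real (1 - (cmod (f p))\<^sup>2) * f p)"
    by (simp only: norm_mult norm_of_real)
  also have "\<dots> = \<epsilon> * cmod (nbr_sum f p)"
    using eq assms by (simp add: norm_mult)
  also have "\<dots> \<le> \<epsilon> * (4 * (1 + 1/100))"
    using assms near_norm_le by (intro mult_left_mono norm_nbr_sum_le) blast+
  finally show ?thesis using assms by simp
qed

text \<open>The derivative of \<open>(1 - r\<^sup>2) r\<close> at \<open>1\<close> is \<open>-2\<close>. This is the invertibility at the nodes.\<close>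

lemma real_cubic_expanding:
  fixes r s :: real
  assumes "\<bar>r - 1\<bar> \<le> 1/100" "\<bar>s - 1\<bar> \<le> 1/100"
  shows "\<bar>r - s\<bar> \<le> \<bar>(1 - r\<^sup>2) * r - (1 - s\<^sup>2) * s\<bar>"
proof -
  have "99/100 \<le> r" "99/100 \<le> s" using assms by linarith+
  then have "98/100 \<le> r * r" "98/100 \<le> r * s" "98/100 \<le> s * s"
    using mult_mono[of "99/100" r "99/100" r] mult_mono[of "99/100" r "99/100" s] mult_mono[of "99/100" s "99/100" s] by auto
  then have "1 \<le> \<bar>1 - (r * r + r * s + s * s)\<bar>" by linarith
  then have "\<bar>r - s\<bar> * 1 \<le> \<bar>r - s\<bar> * \<bar>1 - (r * r + r * s + s * s)\<bar>"
    by (intro mult_left_mono) auto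
  also have "\<dots> = \<bar>(1 - r\<^sup>2) * r - (1 - s\<^sup>2) * s\<bar>"
    unfolding abs_mult[symmetric] by (simp add: algebra_simps power2_eq_square)
  finally show ?thesis by simp
qed

text \<open>The difference of two solutions is bounded by a small multiple of its supremum: away from the
  nodes the neighbour sum carries \<open>\<epsilon>\<close> and the cubic term the square of the amplitude, at the nodes the
  amplitude equation is expanding and its right-hand side carries \<open>\<epsilon>\<close>.\<close>

lemma proj_solves_unique:
  assumes f: "proj_solves \<epsilon> f" "near (1/100) f" and g: "proj_solves \<epsilon> g" "near (1/100) g"
    and e: "0 \<le> \<epsilon>" "\<epsilon> \<le> 1/100"
  shows "f = g"
proof
  fix p0
  let ?D = "\<lambda>q. f q - g q"
  have "cmod (?D p) \<le> M / 2 + 0" if M: "\<And>q. cmod (?D q) \<le> M" for M p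
  proof (cases "p \<in> nodes")
    case False
    have "(1 - complex_of_real ((cmod (f p))\<^sup>2)) * f p = complex_of_real \<epsilon> * nbr_sum f p"
      "(1 - complex_of_real ((cmod (g p))\<^sup>2)) * g p = complex_of_real \<epsilon> * nbr_sum g p"
      using f g False proj_solves_off by blast+
    then have "?D p = complex_of_real \<epsilon> * nbr_sum ?D p +
       (complex_of_real ((cmod (f p))\<^sup>2) * f p - complex_of_real ((cmod (g p))\<^sup>2) * g p)"
      unfolding nbr_sum_diff[symmetric] by (simp add: algebra_simps)
    also have "cmod \<dots> \<le> \<epsilon> * (4 * M) + 3 * (1/100)\<^sup>2 * M"
    proof (intro order_trans[OF norm_triangle_ineq] add_mono)
      show "cmod (complex_of_real \<epsilon> * nbr_sum ?D p) \<le> \<epsilon> * (4 * M)"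
        using e norm_nbr_sum_le[of ?D M p, OF M] by (simp add: norm_mult mult_left_mono)
      have "cmod (complex_of_real ((cmod (f p))\<^sup>2) * f p - complex_of_real ((cmod (g p))\<^sup>2) * g p)
          \<le> 3 * (1/100)\<^sup>2 * cmod (?D p)"
        using near_off[OF f(2) False] near_off[OF g(2) False] by (rule cubic_diff)
      then show "cmod (complex_of_real ((cmod (f p))\<^sup>2) * f p - complex_of_real ((cmod (g p))\<^sup>2) * g p)
          \<le> 3 * (1/100)\<^sup>2 * M" by (rule order_trans) (intro mult_left_mono M, simp)
    qed
    also have "\<dots> \<le> 1/100 * (4 * M) + 3 * (1/100)\<^sup>2 * M"
      using e order_trans[OF norm_ge_zero M[of p]] by (intro add_mono mult_right_mono) auto
    also have "\<dots> \<le> M / 2 + 0" using order_trans[OF norm_ge_zero M[of p]] by (simp add: power2_eq_square)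
    finally show ?thesis .
  next
    case True
    have ph: "vort p * cnj (vort p) = 1" using True by (auto simp: nodes_def vort_def)
    have key: "\<exists>r. f p = complex_of_real r * vort p \<and> \<bar>r - 1\<bar> \<le> 1/100 \<and> (1 - r\<^sup>2) * r = \<epsilon> * Re (cnj (vort p) * nbr_sum f p)"
      if f: "proj_solves \<epsilon> f" "near (1/100) f" for f
    proof -
      define r where "r = Re (cnj (vort p) * f p)"
      have im: "Im (cnj (vort p) * f p) = 0" and
        re: "Re (cnj (vort p) * ((1 - complex_of_real ((cmod (f p))\<^sup>2)) * f p - complex_of_real \<epsilon> * nbr_sum f p)) = 0"
        using proj_solves_node[OF f(1) True] by auto
      have r: "cnj (vort p) * f p = complex_of_real r" using im by (simp add: r_def complex_eq_iff)
      have "f p = vort p * (cnj (vort p) * f p)" using ph by (simp add: mult.assoc[symmetric])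
      then have "f p = vort p * complex_of_real r" by (simp only: r)
      then have fr: "f p = complex_of_real r * vort p" by (simp only: mult.commute)
      have "f p - vort p = complex_of_real (r - 1) * vort p" unfolding fr by (simp add: algebra_simps)
      then have "cmod (f p - vort p) = \<bar>r - 1\<bar>"
        using norm_vort[OF True] by (simp only: norm_mult norm_of_real) simp
      moreover have "cmod (f p - vort p) \<le> 1/100" using f(2) by (auto simp: near_def)
      moreover have "(cmod (f p))\<^sup>2 = r\<^sup>2" unfolding fr using norm_vort[OF True] by (simp add: norm_mult)
      then have "cnj (vort p) * ((1 - complex_of_real ((cmod (f p))\<^sup>2)) * f p) = complex_of_real ((1 - r\<^sup>2) * r) * (vort p * cnj (vort p))"
        unfolding fr by (simp add: mult_ac)
      then have "Re (cnj (vort p) * ((1 - complex_of_real ((cmod (f p))\<^sup>2)) * f p)) = (1 - r\<^sup>2) * r"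
        unfolding ph by simp
      moreover have "Re (cnj (vort p) * (complex_of_real \<epsilon> * nbr_sum f p)) = \<epsilon> * Re (cnj (vort p) * nbr_sum f p)"
        by (simp add: algebra_simps)
      ultimately show ?thesis using fr re by (intro exI[of _ r]) (simp only: right_diff_distrib minus_complex.simps, simp)
    qed
    obtain r where r: "f p = complex_of_real r * vort p" "\<bar>r - 1\<bar> \<le> 1/100" "(1 - r\<^sup>2) * r = \<epsilon> * Re (cnj (vort p) * nbr_sum f p)"
      using key[OF f] by blast
    obtain s where s: "g p = complex_of_real s * vort p" "\<bar>s - 1\<bar> \<le> 1/100" "(1 - s\<^sup>2) * s = \<epsilon> * Re (cnj (vort p) * nbr_sum g p)"
      using key[OF g] by blast
    have "?D p = complex_of_real (r - s) * vort p" unfolding r(1) s(1) by (simp add: algebra_simps)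
    then have "cmod (?D p) = \<bar>r - s\<bar>" using norm_vort[OF True] by (simp only: norm_mult norm_of_real) simp
    also have "\<dots> \<le> \<bar>(1 - r\<^sup>2) * r - (1 - s\<^sup>2) * s\<bar>" by (rule real_cubic_expanding[OF r(2) s(2)])
    also have "(1 - r\<^sup>2) * r - (1 - s\<^sup>2) * s = \<epsilon> * Re (cnj (vort p) * nbr_sum ?D p)"
      unfolding r(3) s(3) nbr_sum_diff[symmetric] by (simp add: algebra_simps)
    also have "\<bar>\<dots>\<bar> \<le> 1/100 * (4 * M)"
    proof -
      have "\<bar>Re (cnj (vort p) * nbr_sum ?D p)\<bar> \<le> 4 * M"
        using abs_Re_le_cmod[of "cnj (vort p) * nbr_sum ?D p"] norm_nbr_sum_le[of ?D M p, OF M]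
          norm_vort[OF True] by (simp add: norm_mult)
      then show ?thesis unfolding abs_mult using e by (intro mult_mono) auto
    qed
    also have "\<dots> \<le> M / 2 + 0" using order_trans[OF norm_ge_zero M[of p]] by simp
    finally show ?thesis .
  qed
  moreover have "cmod (?D p) \<le> 4" for p
    using near_norm_le[OF f(2), of p] near_norm_le[OF g(2), of p] norm_triangle_ineq4[of "f p" "g p"] by linarith
  ultimately have "cmod (?D p0) \<le> 2 * 0" by (rule self_improving_bound[rotated])
  then show "f p0 = g p0" by simp
qed

section \<open>Symmetries and the full equation\<close>

text \<open>The rotations and reflections of the complex plane about the origin: the symmetries of the cubic
  nonlinearity.\<close>

definition phase_map :: "(complex \<Rightarrow> complex) \<Rightarrow> bool" where
  "phase_map h \<longleftrightarrow> (\<exists>u. cmod u = 1 \<and> (h = (\<lambda>z. u * z) \<or> h = (\<lambda>z. u * cnj z)))"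

definition nbr_symmetry :: "(int \<times> int \<Rightarrow> int \<times> int) \<Rightarrow> bool" where
  "nbr_symmetry \<sigma> \<longleftrightarrow> (\<forall>(f :: int \<times> int \<Rightarrow> complex) p. nbr_sum (\<lambda>q. f (\<sigma> q)) p = nbr_sum f (\<sigma> p))"

lemma phase_mapD:
  assumes "phase_map h"
  shows "h (x + y) = h x + h y" "h (x - y) = h x - h y" "h (of_real r * x) = of_real r * h x" "cmod (h x) = cmod x"
    "Re (cnj (h x) * h y) = Re (cnj x * y)" "Im (cnj (h x) * h y) = 0 \<longleftrightarrow> Im (cnj x * y) = 0"
proof -
  obtain u where u: "cmod u = 1" "h = (\<lambda>z. u * z) \<or> h = (\<lambda>z. u * cnj z)"
    using assms by (auto simp: phase_map_def)
  have uu: "cnj u * u = 1" using u(1) by (simp add: complex_norm_square[symmetric] mult.commute)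
  have "cnj (h x) * h y = (cnj u * u) * (cnj x * y) \<or> cnj (h x) * h y = (cnj u * u) * cnj (cnj x * y)"
    using u(2) by (auto simp: mult_ac)
  then have c: "cnj (h x) * h y = cnj x * y \<or> cnj (h x) * h y = cnj (cnj x * y)" unfolding uu by simp
  then show "Re (cnj (h x) * h y) = Re (cnj x * y)" "Im (cnj (h x) * h y) = 0 \<longleftrightarrow> Im (cnj x * y) = 0"
    by (elim disjE; simp only: cnj.simps neg_equal_0_iff_equal)+
  show "h (x + y) = h x + h y" "h (x - y) = h x - h y" "h (of_real r * x) = of_real r * h x" "cmod (h x) = cmod x"
    using u by (auto simp: algebra_simps norm_mult)
qed

lemma nbr_sum_symmetric:
  assumes "phase_map h" "nbr_symmetry \<sigma>"
  shows "nbr_sum (\<lambda>q. h (f (\<sigma> q))) p = h (nbr_sum f (\<sigma> p))"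
proof -
  have "nbr_sum (\<lambda>q. h (f (\<sigma> q))) p = nbr_sum (\<lambda>q. h (f q)) (\<sigma> p)"
    using assms(2)[unfolded nbr_symmetry_def, rule_format, of "\<lambda>q. h (f q)" p] .
  also have "\<dots> = h (nbr_sum f (\<sigma> p))"
    by (cases "\<sigma> p") (simp add: nbr_sum_def phase_mapD(1)[OF assms(1)])
  finally show ?thesis .
qed

lemma residual_symmetric:
  assumes "phase_map h" "nbr_symmetry \<sigma>"
  shows "(1 - complex_of_real ((cmod (h (f (\<sigma> p))))\<^sup>2)) * h (f (\<sigma> p)) - complex_of_real \<epsilon> * nbr_sum (\<lambda>q. h (f (\<sigma> q))) p
    = h ((1 - complex_of_real ((cmod (f (\<sigma> p)))\<^sup>2)) * f (\<sigma> p) - complex_of_real \<epsilon> * nbr_sum f (\<sigma> p))"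
  using phase_mapD(3)[OF assms(1), of "1 - (cmod (f (\<sigma> p)))\<^sup>2" "f (\<sigma> p)"]
  by (simp add: nbr_sum_symmetric[OF assms] phase_mapD[OF assms(1)])

lemma solves_symmetric:
  assumes h: "phase_map h" "nbr_symmetry \<sigma>" and f: "solves \<epsilon> f"
  shows "solves \<epsilon> (\<lambda>q. h (f (\<sigma> q)))"
proof -
  have "h 0 = 0" using phase_mapD(3)[OF h(1), of 0 0] by simp
  then show ?thesis
    using f residual_symmetric[OF h, of f _ \<epsilon>] unfolding solves_def
    by (metis (no_types, lifting) eq_iff_diff_eq_0)
qed

lemma near_symmetric:
  assumes h: "phase_map h" and v: "\<And>p. vort p = h (vort (\<sigma> p))" and f: "near \<eta> f"
  shows "near \<eta> (\<lambda>q. h (f (\<sigma> q)))"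
  unfolding near_def
proof
  fix p
  have "h (f (\<sigma> p)) - vort p = h (f (\<sigma> p) - vort (\<sigma> p))"
    by (simp add: phase_mapD(2)[OF h] v[of p])
  then show "cmod (h (f (\<sigma> p)) - vort p) \<le> \<eta>"
    using f by (simp add: phase_mapD(4)[OF h] near_def)
qed

lemma proj_solves_symmetric:
  assumes h: "phase_map h" "nbr_symmetry \<sigma>" and n: "\<And>p. \<sigma> p \<in> nodes \<longleftrightarrow> p \<in> nodes"
    and v: "\<And>p. vort p = h (vort (\<sigma> p))" and f: "proj_solves \<epsilon> f"
  shows "proj_solves \<epsilon> (\<lambda>q. h (f (\<sigma> q)))"
proof -
  have h0: "h 0 = 0" using phase_mapD(3)[OF h(1), of 0 0] by simp
  show ?thesis unfolding proj_solves_def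
  proof
    fix p
    show "if p \<in> nodes then Im (cnj (vort p) * h (f (\<sigma> p))) = 0 \<and>
       Re (cnj (vort p) * ((1 - complex_of_real ((cmod (h (f (\<sigma> p))))\<^sup>2)) * h (f (\<sigma> p)) - complex_of_real \<epsilon> * nbr_sum (\<lambda>q. h (f (\<sigma> q))) p)) = 0
     else (1 - complex_of_real ((cmod (h (f (\<sigma> p))))\<^sup>2)) * h (f (\<sigma> p)) = complex_of_real \<epsilon> * nbr_sum (\<lambda>q. h (f (\<sigma> q))) p"
    proof (cases "p \<in> nodes")
      case True
      then have "Im (cnj (vort (\<sigma> p)) * f (\<sigma> p)) = 0"
        "Re (cnj (vort (\<sigma> p)) * ((1 - complex_of_real ((cmod (f (\<sigma> p)))\<^sup>2)) * f (\<sigma> p) - complex_of_real \<epsilon> * nbr_sum f (\<sigma> p))) = 0"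
        using proj_solves_node[OF f, of "\<sigma> p"] n[of p] by blast+
      then show ?thesis using True unfolding residual_symmetric[OF h] v[of p] phase_mapD(5,6)[OF h(1)] by simp
    next
      case False
      then have "(1 - complex_of_real ((cmod (f (\<sigma> p)))\<^sup>2)) * f (\<sigma> p) - complex_of_real \<epsilon> * nbr_sum f (\<sigma> p) = 0"
        using proj_solves_off[OF f, of "\<sigma> p"] n[of p] by simp
      then show ?thesis using False residual_symmetric[OF h, of f p \<epsilon>] h0 by simp
    qed
  qed
qed

lemma phase_maps: "phase_map cnj" "phase_map (\<lambda>z. - cnj z)" "phase_map uminus" "phase_map (\<lambda>z. - \<i> * z)"
  "cmod u = 1 \<Longrightarrow> phase_map (\<lambda>z. u * z)"
proof -
  have "phase_map (\<lambda>z. u * z)" "phase_map (\<lambda>z. u * cnj z)" if "cmod u = 1" for u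
    using that by (auto simp: phase_map_def)
  from this(1) this(2)[of 1] this(2)[of "-1"] this(1)[of "-1"] this(1)[of "- \<i>"]
  show "phase_map cnj" "phase_map (\<lambda>z. - cnj z)" "phase_map uminus" "phase_map (\<lambda>z. - \<i> * z)"
    "cmod u = 1 \<Longrightarrow> phase_map (\<lambda>z. u * z)" by simp_all
qed

lemma nbr_symmetries: "nbr_symmetry (\<lambda>p. (fst p, - snd p))" "nbr_symmetry (\<lambda>p. (- fst p, snd p))"
  "nbr_symmetry (\<lambda>p. (- fst p, - snd p))" "nbr_symmetry (\<lambda>p. (- snd p, fst p))" "nbr_symmetry (\<lambda>p. p)"
  by (auto simp: nbr_symmetry_def nbr_sum_def algebra_simps)

text \<open>Recovers the full equation at a node from its component along \<open>vort\<close>, once both sides are known to be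
  parallel to \<open>vort\<close>; there \<open>c\<close> is the conjugate of \<open>vort\<close>.\<close>

lemma eq_of_Re_eq:
  assumes "c \<noteq> 0" "Im (c * x) = 0" "Im (c * y) = 0"
    and "Re (c * (complex_of_real r * x - complex_of_real s * y)) = 0"
  shows "complex_of_real r * x = complex_of_real s * y"
proof -
  have "c * (complex_of_real r * x - complex_of_real s * y) = complex_of_real r * (c * x) - complex_of_real s * (c * y)"
    by (simp add: algebra_simps)
  moreover have "Im (complex_of_real r * u - complex_of_real s * w) = 0" if "Im u = 0" "Im w = 0" for u w
    using that by simp
  ultimately have "Im (c * (complex_of_real r * x - complex_of_real s * y)) = 0"
    using assms(2,3) by (simp only:)
  then have "c * (complex_of_real r * x - complex_of_real s * y) = 0"
    using assms(4) by (simp only: complex_eq_iff zero_complex.simps)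
  then show ?thesis using assms(1) by simp
qed

text \<open>By uniqueness for the projected problem the solution is invariant under \<open>(n, m) \<mapsto> (n, -m)\<close> with
  \<open>z \<mapsto> cnj z\<close> and under \<open>(n, m) \<mapsto> (-n, m)\<close> with \<open>z \<mapsto> - cnj z\<close>. The first fixes the nodes on the
  horizontal axis and makes the neighbour sum there real, the second makes it imaginary at the nodes on the
  vertical axis.\<close>

lemma vortex_solves:
  assumes e: "0 \<le> \<epsilon>" "\<epsilon> \<le> 1/5000"
  shows "near (1/100) (entry (vortex \<epsilon>))" "solves \<epsilon> (entry (vortex \<epsilon>))"
proof -
  let ?f = "entry (vortex \<epsilon>)"
  have near: "near (1/100) ?f"
    unfolding near_def
  proof
    fix p
    have "cmod (?f p - vort p) \<le> norm (vortex \<epsilon> - vortex_limit)"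
      using norm_entry_le[of "vortex \<epsilon> - vortex_limit" p] by (simp add: minus_ell2.rep_eq entry_vortex_limit)
    also have "\<dots> \<le> 1/100" using vortex_near[of \<epsilon>] e by simp
    finally show "cmod (?f p - vort p) \<le> 1/100" .
  qed
  then show "near (1/100) ?f" .
  have ps: "proj_solves \<epsilon> ?f" using vortex_proj_solves e by simp
  have K: "(\<lambda>p. cnj (?f (fst p, - snd p))) = ?f"
  proof (rule proj_solves_unique[OF _ _ ps near])
    show "proj_solves \<epsilon> (\<lambda>p. cnj (?f (fst p, - snd p)))"
      by (rule proj_solves_symmetric[OF phase_maps(1) nbr_symmetries(1) _ _ ps]) (auto simp: nodes_def vort_def)
    show "near (1/100) (\<lambda>p. cnj (?f (fst p, - snd p)))"
      by (rule near_symmetric[OF phase_maps(1) _ near]) (auto simp: vort_def)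
  qed (use e in auto)
  have K': "(\<lambda>p. - cnj (?f (- fst p, snd p))) = ?f"
  proof (rule proj_solves_unique[OF _ _ ps near])
    show "proj_solves \<epsilon> (\<lambda>p. - cnj (?f (- fst p, snd p)))"
      by (rule proj_solves_symmetric[OF phase_maps(2) nbr_symmetries(2) _ _ ps]) (auto simp: nodes_def vort_def)
    show "near (1/100) (\<lambda>p. - cnj (?f (- fst p, snd p)))"
      by (rule near_symmetric[OF phase_maps(2) _ near]) (auto simp: vort_def)
  qed (use e in auto)
  show "solves \<epsilon> ?f" unfolding solves_def
  proof
    fix p
    show "(1 - complex_of_real ((cmod (?f p))\<^sup>2)) * ?f p = complex_of_real \<epsilon> * nbr_sum ?f p"
    proof (cases "p \<in> nodes")
      case False then show ?thesis using ps by (rule proj_solves_off[rotated])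
    next
      case True
      have *: "Im (nbr_sum ?f p) = 0" if "p = (-1, 0) \<or> p = (1, 0)"
      proof -
        have q: "(fst p, - snd p) = p" using that by auto
        have "nbr_sum ?f p = cnj (nbr_sum ?f p)"
          using nbr_sum_symmetric[OF phase_maps(1) nbr_symmetries(1), of ?f p] unfolding K q .
        then show ?thesis by (metis Reals_cnj_iff complex_is_Real_iff)
      qed
      have **: "Re (nbr_sum ?f p) = 0" if "p = (0, -1) \<or> p = (0, 1)"
      proof -
        have q: "(- fst p, snd p) = p" using that by auto
        have "nbr_sum ?f p = - cnj (nbr_sum ?f p)"
          using nbr_sum_symmetric[OF phase_maps(2) nbr_symmetries(2), of ?f p] unfolding K' q .
        then have "Re (nbr_sum ?f p) = Re (- cnj (nbr_sum ?f p))" by (rule arg_cong)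
        then show ?thesis by simp
      qed
      have im': "Im (cnj (vort p) * nbr_sum ?f p) = 0"
      proof -
        consider "p = (-1, 0)" | "p = (0, -1)" | "p = (1, 0)" | "p = (0, 1)"
          using True unfolding nodes_def by (elim insertE emptyE)
        then show ?thesis
          by cases (use * ** in \<open>simp_all add: vort_def\<close>)
      qed
      have "cnj (vort p) \<noteq> 0" using norm_vort[OF True] by force
      then show ?thesis
        using eq_of_Re_eq[OF _ proj_solves_node(1)[OF ps True] im', of "1 - (cmod (?f p))\<^sup>2" \<epsilon>]
          proj_solves_node(2)[OF ps True] by simp
    qed
  qed
qed

section \<open>Solutions near the vortex are odd\<close>

lemma solvesD:
  "solves \<epsilon> f \<Longrightarrow> (1 - complex_of_real ((cmod (f p))\<^sup>2)) * f p = complex_of_real \<epsilon> * nbr_sum f p"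
  by (simp add: solves_def)

text \<open>The second-order interaction of \<open>(-1, 0)\<close> with the nodes: going out to a neighbour and back. The
  coefficient of each node counts the paths of length two from it to \<open>(-1, 0)\<close>. The lemma serves both for a
  solution and for a difference of two solutions.\<close>

lemma two_step_nbr_sum:
  assumes e: "0 \<le> \<epsilon>"
    and res: "\<And>q. q \<notin> nodes \<Longrightarrow> cmod (F q - complex_of_real \<epsilon> * nbr_sum F q) \<le> \<kappa>"
    and off: "\<And>q. q \<notin> nodes \<Longrightarrow> cmod (F q) \<le> \<mu>"
  shows "cmod (F (-1, -1) - complex_of_real \<epsilon> * (F (-1, 0) + F (0, -1))) \<le> \<kappa> + 2 * \<epsilon> * \<mu>"
    "cmod (F (-1, 1) - complex_of_real \<epsilon> * (F (-1, 0) + F (0, 1))) \<le> \<kappa> + 2 * \<epsilon> * \<mu>"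
    "cmod (nbr_sum F (-1, 0) - complex_of_real \<epsilon> *
       (4 * F (-1, 0) + F (1, 0) + 2 * F (0, -1) + 2 * F (0, 1))) \<le> 4 * \<kappa> + 7 * \<epsilon> * \<mu>"
proof -
  let ?e = "complex_of_real \<epsilon>"
  have off': "cmod (?e * F q) \<le> \<epsilon> * \<mu>" if "q \<notin> nodes" for q
    using off[OF that] e by (simp add: norm_mult mult_left_mono)
  have n: "(-1, -1) \<notin> nodes" "(-1, 1) \<notin> nodes" "(-2, 0) \<notin> nodes" "(0, 0) \<notin> nodes"
    "(-2, -1) \<notin> nodes" "(-1, -2) \<notin> nodes" "(-2, 1) \<notin> nodes" "(-1, 2) \<notin> nodes" "(-3, 0) \<notin> nodes"
    by (auto simp: nodes_def)
  have s1: "nbr_sum F (-1, -1) = F (0, -1) + F (-2, -1) + F (-1, 0) + F (-1, -2)"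
    and s2: "nbr_sum F (-1, 1) = F (0, 1) + F (-2, 1) + F (-1, 2) + F (-1, 0)"
    and s3: "nbr_sum F (-2, 0) = F (-1, 0) + F (-3, 0) + F (-2, 1) + F (-2, -1)"
    and s4: "nbr_sum F (0, 0) = F (1, 0) + F (-1, 0) + F (0, 1) + F (0, -1)"
    and s5: "nbr_sum F (-1, 0) = F (0, 0) + F (-2, 0) + F (-1, 1) + F (-1, -1)"
    by (simp_all add: nbr_sum_def)
  define r1 where "r1 = F (-1, -1) - ?e * nbr_sum F (-1, -1)"
  define r2 where "r2 = F (-1, 1) - ?e * nbr_sum F (-1, 1)"
  define r3 where "r3 = F (-2, 0) - ?e * nbr_sum F (-2, 0)"
  define r4 where "r4 = F (0, 0) - ?e * nbr_sum F (0, 0)"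
  have r: "cmod r1 \<le> \<kappa>" "cmod r2 \<le> \<kappa>" "cmod r3 \<le> \<kappa>" "cmod r4 \<le> \<kappa>"
    using res n by (auto simp: r1_def r2_def r3_def r4_def)
  have "F (-1, -1) - ?e * (F (-1, 0) + F (0, -1)) = r1 + ?e * F (-2, -1) + ?e * F (-1, -2)"
    unfolding r1_def s1 by (simp add: algebra_simps)
  also have "cmod \<dots> \<le> cmod r1 + cmod (?e * F (-2, -1)) + cmod (?e * F (-1, -2))" by norm
  finally show 1: "cmod (F (-1, -1) - ?e * (F (-1, 0) + F (0, -1))) \<le> \<kappa> + 2 * \<epsilon> * \<mu>"
    using r(1) off'[OF n(5)] off'[OF n(6)] by linarith
  have "F (-1, 1) - ?e * (F (-1, 0) + F (0, 1)) = r2 + ?e * F (-2, 1) + ?e * F (-1, 2)"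
    unfolding r2_def s2 by (simp add: algebra_simps)
  also have "cmod \<dots> \<le> cmod r2 + cmod (?e * F (-2, 1)) + cmod (?e * F (-1, 2))" by norm
  finally show 2: "cmod (F (-1, 1) - ?e * (F (-1, 0) + F (0, 1))) \<le> \<kappa> + 2 * \<epsilon> * \<mu>"
    using r(2) off'[OF n(7)] off'[OF n(8)] by linarith
  have "nbr_sum F (-1, 0) - ?e * (4 * F (-1, 0) + F (1, 0) + 2 * F (0, -1) + 2 * F (0, 1)) =
      r4 + (r3 + ?e * F (-3, 0) + ?e * F (-2, 1) + ?e * F (-2, -1)) +
      (F (-1, 1) - ?e * (F (-1, 0) + F (0, 1))) + (F (-1, -1) - ?e * (F (-1, 0) + F (0, -1)))"
    unfolding r4_def r3_def s3 s4 s5 by (simp add: algebra_simps)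
  also have "cmod \<dots> \<le> cmod r4 + (cmod r3 + cmod (?e * F (-3, 0)) + cmod (?e * F (-2, 1)) + cmod (?e * F (-2, -1))) +
      cmod (F (-1, 1) - ?e * (F (-1, 0) + F (0, 1))) + cmod (F (-1, -1) - ?e * (F (-1, 0) + F (0, -1)))"
    by (intro order_trans[OF norm_triangle_ineq] add_mono order_refl)
  finally show "cmod (nbr_sum F (-1, 0) - ?e * (4 * F (-1, 0) + F (1, 0) + 2 * F (0, -1) + 2 * F (0, 1))) \<le> 4 * \<kappa> + 7 * \<epsilon> * \<mu>"
    using r(3,4) off'[OF n(9)] off'[OF n(7)] off'[OF n(5)] 1 2 by linarith
qed

lemma off_node_residual:
  assumes f: "solves \<epsilon> f" "near (1/100) f" and e: "0 \<le> \<epsilon>" "\<epsilon> \<le> 1/10000" and p: "p \<notin> nodes"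
  shows "cmod (f p - complex_of_real \<epsilon> * nbr_sum f p) \<le> \<epsilon>\<^sup>2"
proof -
  have b: "cmod (f p) \<le> 5 * \<epsilon>" by (rule off_node_bound[OF f(2) e(1) p solvesD[OF f(1)]])
  have "f p - complex_of_real \<epsilon> * nbr_sum f p = complex_of_real ((cmod (f p))\<^sup>2) * f p"
    using solvesD[OF f(1), of p] by (simp add: algebra_simps)
  then have "cmod (f p - complex_of_real \<epsilon> * nbr_sum f p) = (cmod (f p))\<^sup>2 * cmod (f p)"
    by (simp only: norm_mult norm_of_real) simp
  also have "\<dots> \<le> (5 * \<epsilon>)\<^sup>2 * (5 * \<epsilon>)" using b by (intro mult_mono power_mono) auto
  also have "\<dots> = \<epsilon>\<^sup>2 * (125 * \<epsilon>)" by (simp add: power2_eq_square)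
  also have "\<dots> \<le> \<epsilon>\<^sup>2 * 1" using e by (intro mult_left_mono) auto
  finally show ?thesis by simp
qed

text \<open>The difference of \<open>f\<close> and the solution \<open>p \<mapsto> - f (- p)\<close>. It is even, so its values at opposite nodes
  coincide, and two values describe it at the nodes.\<close>

definition parity_defect :: "(int \<times> int \<Rightarrow> complex) \<Rightarrow> int \<times> int \<Rightarrow> complex" where
  "parity_defect f p = f p + f (- fst p, - snd p)"

lemma abs_Im_mult_le: "cmod a \<le> A \<Longrightarrow> cmod b \<le> B \<Longrightarrow> 0 \<le> A \<Longrightarrow> \<bar>Im (a * b)\<bar> \<le> A * B"
  by (rule order_trans[OF abs_Im_le_cmod]) (auto simp: norm_mult intro: mult_mono)

lemma abs_Re_mult_le: "cmod a \<le> A \<Longrightarrow> cmod b \<le> B \<Longrightarrow> 0 \<le> A \<Longrightarrow> \<bar>Re (a * b)\<bar> \<le> A * B"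
  by (rule order_trans[OF abs_Re_le_cmod]) (auto simp: norm_mult intro: mult_mono)

context
  fixes f :: "int \<times> int \<Rightarrow> complex" and \<epsilon> M :: real
  assumes f: "solves \<epsilon> f" "near (1/100) f" and e: "0 < \<epsilon>" "\<epsilon> \<le> 1/10000"
    and M: "\<And>p. cmod (parity_defect f p) \<le> M"
begin

lemma defect_bound_nonneg: "0 \<le> M"
  using M[of "(0, 0)"] norm_ge_zero order_trans by blast

lemma opposite_solution:
  "solves \<epsilon> (\<lambda>p. - f (- fst p, - snd p))" "near (1/100) (\<lambda>p. - f (- fst p, - snd p))"
  by (rule solves_symmetric[OF phase_maps(3) nbr_symmetries(3) f(1)],
      rule near_symmetric[OF phase_maps(3) _ f(2)]) (auto simp: vort_def)

lemma defect_off: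
  assumes p: "p \<notin> nodes"
  shows "cmod (parity_defect f p) \<le> 5 * \<epsilon> * M"
    "cmod (parity_defect f p - complex_of_real \<epsilon> * nbr_sum (parity_defect f) p) \<le> \<epsilon>\<^sup>2 * M"
proof -
  let ?g = "\<lambda>p. - f (- fst p, - snd p)" and ?D = "parity_defect f"
  have D: "?D = (\<lambda>q. f q - ?g q)" by (auto simp: parity_defect_def)
  have bf: "cmod (f p) \<le> 5 * \<epsilon>" using off_node_bound[OF f(2) _ p solvesD[OF f(1)]] e by simp
  have bg: "cmod (?g p) \<le> 5 * \<epsilon>"
    using off_node_bound[OF opposite_solution(2) _ p solvesD[OF opposite_solution(1), of p]] e by simp
  have "?D p - complex_of_real \<epsilon> * nbr_sum ?D p =
     complex_of_real ((cmod (f p))\<^sup>2) * f p - complex_of_real ((cmod (?g p))\<^sup>2) * ?g p"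
    using solvesD[OF f(1), of p] solvesD[OF opposite_solution(1), of p]
    unfolding D nbr_sum_diff[symmetric] by (simp add: algebra_simps)
  then have res: "cmod (?D p - complex_of_real \<epsilon> * nbr_sum ?D p) \<le> 3 * (5 * \<epsilon>)\<^sup>2 * cmod (?D p)"
    using cubic_diff[OF bf bg] by (simp add: D)
  also have "\<dots> \<le> 3 * (5 * \<epsilon>)\<^sup>2 * M" by (intro mult_left_mono M) auto
  also have "\<dots> = (75 * \<epsilon>) * (\<epsilon> * M)" by (simp add: power2_eq_square)
  also have "\<dots> \<le> 1 * (\<epsilon> * M)" using e defect_bound_nonneg by (intro mult_right_mono) auto
  finally have "cmod (?D p - complex_of_real \<epsilon> * nbr_sum ?D p) \<le> \<epsilon> * M" by simp
  moreover have "cmod (complex_of_real \<epsilon> * nbr_sum ?D p) \<le> \<epsilon> * (4 * M)"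
    using norm_nbr_sum_le[of ?D M p, OF M] e by (simp add: norm_mult)
  ultimately show b: "cmod (?D p) \<le> 5 * \<epsilon> * M"
    using norm_triangle_sub[of "?D p" "complex_of_real \<epsilon> * nbr_sum ?D p"] by linarith
  note res
  also have "3 * (5 * \<epsilon>)\<^sup>2 * cmod (?D p) \<le> 3 * (5 * \<epsilon>)\<^sup>2 * (5 * \<epsilon> * M)" using b by (intro mult_left_mono) auto
  also have "\<dots> = (375 * \<epsilon>) * (\<epsilon>\<^sup>2 * M)" by (simp add: power2_eq_square)
  also have "\<dots> \<le> 1 * (\<epsilon>\<^sup>2 * M)" using e defect_bound_nonneg by (intro mult_right_mono) auto
  finally show "cmod (?D p - complex_of_real \<epsilon> * nbr_sum ?D p) \<le> \<epsilon>\<^sup>2 * M" by simp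
qed

text \<open>With \<open>x\<close> and \<open>y\<close> the values of the defect at \<open>(-1, 0)\<close> and \<open>(0, -1)\<close>, the difference of the amplitude
  equations makes the radial part \<open>Re x\<close> small. The difference of the conservation laws is, to leading
  order,
  \<open>\<epsilon> Im (3 * cnj x + 5 * x + 4 * y) = \<epsilon> (2 * Im x + 4 * Im y)\<close>:
  the coefficient \<open>3\<close> comes from the neighbour sum of the vortex itself and \<open>5\<close>, \<open>4\<close> from that of the
  even defect. At \<open>(0, -1)\<close> the radial part is \<open>Im y\<close>, so the two estimates, the first one also for the
  rotated solution, bound everything.\<close>

lemma defect_node_estimates:
  defines "x \<equiv> parity_defect f (-1, 0)" and "y \<equiv> parity_defect f (0, -1)"
  shows "\<bar>Re x\<bar> \<le> M / 20" "\<bar>Im x + 2 * Im y\<bar> \<le> M / 10"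
proof -
  let ?e = "complex_of_real \<epsilon>" and ?D = "parity_defect f"
  define a where "a = f (-1, 0)"
  define g where "g = - f (1, 0)"
  define l where "l = nbr_sum f (-1, 0)"
  define k where "k = nbr_sum ?D (-1, 0)"
  have x: "x = a - g" by (simp add: x_def a_def g_def parity_defect_def)
  have xM: "cmod x \<le> M" and yM: "cmod y \<le> M" unfolding x_def y_def by (rule M)+
  have a1: "cmod (a - 1) \<le> 1/100" using nearD[OF f(2), of "(-1, 0)"] by (simp add: a_def vort_def)
  have g1: "cmod (g - 1) \<le> 1/100"
    using nearD[OF f(2), of "(1, 0)"] norm_minus_cancel[of "f (1, 0) + 1"] by (simp add: g_def vort_def)
  have a1': "cmod (cnj (a - 1)) \<le> 1/100" and g1': "cmod (cnj (g - 1)) \<le> 1/100"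
    using a1 g1 by (simp_all only: complex_mod_cnj)
  have b1: "cmod (f (0, -1) - \<i>) \<le> 1/100" using nearD[OF f(2), of "(0, -1)"] by (simp add: vort_def)
  have b2: "cmod (f (0, 1) + \<i>) \<le> 1/100" using nearD[OF f(2), of "(0, 1)"] by (simp add: vort_def)
  have ga: "cmod g \<le> 101/100" using g1 norm_triangle_sub[of g 1] by simp
  have ga': "99/100 \<le> cmod g" using g1 norm_triangle_sub[of 1 g] by (simp add: norm_minus_commute)
  have aa: "cmod a \<le> 101/100" using a1 norm_triangle_sub[of a 1] by simp
  have aa': "99/100 \<le> cmod a" using a1 norm_triangle_sub[of 1 a] by (simp add: norm_minus_commute)
  have eq_a: "(1 - complex_of_real ((cmod a)\<^sup>2)) * a = ?e * l"
    using solvesD[OF f(1), of "(-1, 0)"] by (simp add: a_def l_def)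
  have eq_g: "(1 - complex_of_real ((cmod g)\<^sup>2)) * g = ?e * (l - k)"
  proof -
    have "nbr_sum (\<lambda>p. - f (- fst p, - snd p)) (-1, 0) = l - k"
      by (simp add: l_def k_def nbr_sum_diff parity_defect_def nbr_sum_def)
    then show ?thesis using solvesD[OF opposite_solution(1), of "(-1, 0)"] by (simp add: g_def)
  qed
  have k4: "cmod k \<le> 4 * M" unfolding k_def by (rule norm_nbr_sum_le[OF M])
  have k: "cmod (k - ?e * (5 * x + 4 * y)) \<le> 39 * \<epsilon>\<^sup>2 * M"
  proof -
    have D1: "?D (1, 0) = x" "?D (0, 1) = y" by (simp_all add: x_def y_def parity_defect_def)
    have "cmod (k - ?e * (4 * x + x + 2 * y + 2 * y)) \<le> 4 * (\<epsilon>\<^sup>2 * M) + 7 * \<epsilon> * (5 * \<epsilon> * M)"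
      unfolding k_def using two_step_nbr_sum(3)[of \<epsilon> ?D, OF _ defect_off(2) defect_off(1)] e
      by (simp add: D1 flip: x_def y_def)
    then show ?thesis by (simp add: power2_eq_square algebra_simps)
  qed
  have l: "cmod (l - ?e * (4 * a - g + 2 * f (0, -1) + 2 * f (0, 1))) \<le> 39 * \<epsilon>\<^sup>2"
  proof -
    have "cmod (f q) \<le> 5 * \<epsilon>" if "q \<notin> nodes" for q
      using off_node_bound[OF f(2) _ that solvesD[OF f(1)]] e by simp
    moreover have "cmod (f q - ?e * nbr_sum f q) \<le> \<epsilon>\<^sup>2" if "q \<notin> nodes" for q
      using off_node_residual[OF f _ e(2) that] e by simp
    ultimately have "cmod (l - ?e * (4 * a + - g + 2 * f (0, -1) + 2 * f (0, 1))) \<le> 4 * \<epsilon>\<^sup>2 + 7 * \<epsilon> * (5 * \<epsilon>)"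
      using two_step_nbr_sum(3)[of \<epsilon> f "\<epsilon>\<^sup>2" "5 * \<epsilon>"] e by (simp add: a_def g_def l_def)
    then show ?thesis by (simp add: power2_eq_square)
  qed

  \<comment> \<open>The amplitude equation: \<open>(cmod a)\<^sup>2 - (cmod g)\<^sup>2\<close> is twice \<open>Re x\<close> to leading order.\<close>
  have sq: "(cmod a)\<^sup>2 - (cmod g)\<^sup>2 = Re (cnj (a + g) * x)"
    unfolding x cmod_power2 by (simp add: algebra_simps power2_eq_square)
  have "complex_of_real ((cmod a)\<^sup>2 - (cmod g)\<^sup>2) * g = complex_of_real (1 - (cmod a)\<^sup>2) * x - ?e * k"
  proof -
    have "complex_of_real ((cmod a)\<^sup>2 - (cmod g)\<^sup>2) * g = complex_of_real (1 - (cmod a)\<^sup>2) * x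
        - ((1 - complex_of_real ((cmod a)\<^sup>2)) * a - (1 - complex_of_real ((cmod g)\<^sup>2)) * g)"
      unfolding x by (simp add: algebra_simps)
    also have "\<dots> = complex_of_real (1 - (cmod a)\<^sup>2) * x - ?e * k"
      unfolding eq_a eq_g by (simp add: algebra_simps)
    finally show ?thesis .
  qed
  then have "\<bar>(cmod a)\<^sup>2 - (cmod g)\<^sup>2\<bar> * cmod g = cmod (complex_of_real (1 - (cmod a)\<^sup>2) * x - ?e * k)"
    by (metis norm_mult norm_of_real)
  also have "\<dots> \<le> cmod (complex_of_real (1 - (cmod a)\<^sup>2) * x) + cmod (?e * k)" by (rule norm_triangle_ineq4)
  also have "\<dots> = \<bar>1 - (cmod a)\<^sup>2\<bar> * cmod x + \<epsilon> * cmod k" using e by (simp only: norm_mult norm_of_real)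
  also have "\<dots> \<le> 21/1000 * M + 1/10000 * (4 * M)"
  proof (intro add_mono mult_mono)
    have "\<bar>1 - (cmod a)\<^sup>2\<bar> = \<bar>1 - cmod a\<bar> * (1 + cmod a)"
    proof -
      have "1 - (cmod a)\<^sup>2 = (1 - cmod a) * (1 + cmod a)" by (simp add: power2_eq_square algebra_simps)
      then show ?thesis by (simp add: abs_mult)
    qed
    also have "\<dots> \<le> 1/100 * (201/100)" using aa aa' by (intro mult_mono) linarith+
    finally show "\<bar>1 - (cmod a)\<^sup>2\<bar> \<le> 21/1000" by simp
  qed (use xM k4 defect_bound_nonneg e in auto)
  finally have "\<bar>(cmod a)\<^sup>2 - (cmod g)\<^sup>2\<bar> * cmod g \<le> 214/10000 * M" by simp
  moreover have "\<bar>(cmod a)\<^sup>2 - (cmod g)\<^sup>2\<bar> * (99/100) \<le> \<bar>(cmod a)\<^sup>2 - (cmod g)\<^sup>2\<bar> * cmod g"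
    using ga' by (intro mult_left_mono) auto
  ultimately have "\<bar>Re (cnj (a + g) * x)\<bar> \<le> 23/1000 * M" unfolding sq using defect_bound_nonneg by linarith
  moreover have "Re (cnj (a + g) * x) = 2 * Re x + Re (cnj (a - 1) * x) + Re (cnj (g - 1) * x)"
    by (simp add: algebra_simps)
  moreover have "\<bar>Re (cnj (a - 1) * x)\<bar> \<le> 1/100 * M" "\<bar>Re (cnj (g - 1) * x)\<bar> \<le> 1/100 * M"
    by (rule abs_Re_mult_le[OF a1' xM], simp, rule abs_Re_mult_le[OF g1' xM], simp)
  ultimately show "\<bar>Re x\<bar> \<le> M / 20" using defect_bound_nonneg by linarith

  \<comment> \<open>The conservation laws for \<open>f\<close> and for the reflected solution are subtracted.\<close>
  have cur: "Im (cnj z * w) = 0" if "(1 - complex_of_real ((cmod z)\<^sup>2)) * z = ?e * w" for z w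
  proof -
    have "?e * (cnj z * w) = complex_of_real (1 - (cmod z)\<^sup>2) * (z * cnj z)"
      using that by (simp add: mult_ac)
    also have "\<dots> = complex_of_real ((1 - (cmod z)\<^sup>2) * (cmod z)\<^sup>2)"
      by (simp only: complex_norm_square[symmetric] of_real_mult)
    finally have "Im (?e * (cnj z * w)) = 0" by (simp only: Im_complex_of_real)
    then show ?thesis using e by simp
  qed
  \<comment> \<open>\<open>L\<close> and \<open>K\<close> are the remainders of the two-step expansions; \<open>d\<close> vanishes for the vortex itself.\<close>
  define L where "L = l - ?e * (4 * a - g + 2 * f (0, -1) + 2 * f (0, 1))"
  define K where "K = k - ?e * (5 * x + 4 * y)"
  define d where "d = x + 2 * (f (0, -1) - \<i>) + 2 * (f (0, 1) + \<i>)"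
  have x2: "cmod x \<le> 2/100" using norm_triangle_ineq4[of "a - 1" "g - 1"] a1 g1 by (simp add: x)
  have "cmod d \<le> 2/100 + 2/100 + 2/100"
    unfolding d_def
  proof (intro order_trans[OF norm_triangle_ineq] add_mono x2)
    show "cmod (2 * (f (0, -1) - \<i>)) \<le> 2/100" using b1 unfolding norm_mult norm_numeral by linarith
    show "cmod (2 * (f (0, 1) + \<i>)) \<le> 2/100" using b2 unfolding norm_mult norm_numeral by linarith
  qed
  then have d: "cmod d \<le> 6/100" by simp
  have lL: "l = ?e * (3 * a + d) + L" by (simp add: L_def d_def x algebra_simps)
  have kK: "k = ?e * (5 * x + 4 * y) + K" by (simp add: K_def)
  have "0 = Im (cnj a * l) - Im (cnj g * (l - k))" using cur[OF eq_a] cur[OF eq_g] by simp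
  also have "\<dots> = Im (cnj x * l) + Im (cnj g * k)" unfolding x by (simp add: algebra_simps)
  also have "\<dots> = \<epsilon> * (2 * Im x + 4 * Im y) + \<epsilon> * (3 * Im (cnj x * (a - 1)) + Im (cnj x * d) + Im (cnj (g - 1) * (5 * x + 4 * y)))
      + Im (cnj x * L) + Im (cnj g * K)"
    unfolding lL kK by (simp add: algebra_simps)
  finally have main: "\<epsilon> * (2 * Im x + 4 * Im y) = - \<epsilon> * (3 * Im (cnj x * (a - 1)) + Im (cnj x * d) + Im (cnj (g - 1) * (5 * x + 4 * y)))
      - Im (cnj x * L) - Im (cnj g * K)" by linarith
  have xy: "cmod (5 * x + 4 * y) \<le> 9 * M"
    using norm_triangle_ineq[of "5 * x" "4 * y"] xM yM by (simp add: norm_mult)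
  have i1: "\<bar>Im (cnj x * (a - 1))\<bar> \<le> M * (1/100)"
    by (rule abs_Im_mult_le) (use xM a1 defect_bound_nonneg in auto)
  have i2: "\<bar>Im (cnj x * d)\<bar> \<le> M * (6/100)"
    by (rule abs_Im_mult_le) (use xM d defect_bound_nonneg in auto)
  have i3: "\<bar>Im (cnj (g - 1) * (5 * x + 4 * y))\<bar> \<le> 1/100 * (9 * M)"
    by (rule abs_Im_mult_le[OF g1' xy]) simp
  have i4: "\<bar>Im (cnj x * L)\<bar> \<le> M * (39 * \<epsilon>\<^sup>2)"
    by (rule abs_Im_mult_le) (use xM l defect_bound_nonneg L_def in auto)
  have i5: "\<bar>Im (cnj g * K)\<bar> \<le> 101/100 * (39 * \<epsilon>\<^sup>2 * M)"
    by (rule abs_Im_mult_le) (use ga k K_def in auto)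
  define c where "c = 3 * Im (cnj x * (a - 1)) + Im (cnj x * d) + Im (cnj (g - 1) * (5 * x + 4 * y))"
  have "\<bar>c\<bar> \<le> 18/100 * M" using i1 i2 i3 unfolding c_def by linarith
  then have "\<epsilon> * \<bar>c\<bar> \<le> \<epsilon> * (18/100 * M)" using e by (intro mult_left_mono) auto
  moreover have "\<bar>\<epsilon> * (2 * Im x + 4 * Im y)\<bar> \<le> \<epsilon> * \<bar>c\<bar> + 80 * (M * \<epsilon>\<^sup>2)"
  proof -
    have "\<bar>\<epsilon> * c\<bar> = \<epsilon> * \<bar>c\<bar>" using e by (simp add: abs_mult)
    moreover have "\<bar>Im (cnj x * L)\<bar> \<le> 39 * (M * \<epsilon>\<^sup>2)" "\<bar>Im (cnj g * K)\<bar> \<le> 40 * (M * \<epsilon>\<^sup>2)"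
      using i4 i5 defect_bound_nonneg mult_nonneg_nonneg[OF defect_bound_nonneg zero_le_power2[of \<epsilon>]]
      by (simp_all only: mult_ac)
    moreover have "\<epsilon> * (2 * Im x + 4 * Im y) = - (\<epsilon> * c) - Im (cnj x * L) - Im (cnj g * K)"
      using main unfolding c_def[symmetric] by (simp only: mult_minus_left)
    ultimately show ?thesis using mult_nonneg_nonneg[OF defect_bound_nonneg zero_le_power2[of \<epsilon>]] by linarith
  qed
  moreover have "\<bar>\<epsilon> * (2 * Im x + 4 * Im y)\<bar> = \<epsilon> * \<bar>2 * Im x + 4 * Im y\<bar>"
    using e by (simp only: abs_mult abs_of_pos)
  moreover have "\<epsilon> * (18/100 * M + 80 * \<epsilon> * M) = \<epsilon> * (18/100 * M) + 80 * (M * \<epsilon>\<^sup>2)"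
    by (simp add: algebra_simps power2_eq_square)
  ultimately have "\<epsilon> * \<bar>2 * Im x + 4 * Im y\<bar> \<le> \<epsilon> * (18/100 * M + 80 * \<epsilon> * M)" by linarith
  then have "\<bar>2 * Im x + 4 * Im y\<bar> \<le> 18/100 * M + 80 * \<epsilon> * M" using e by simp
  moreover have "80 * \<epsilon> * M \<le> 80 * (1/10000) * M" using e defect_bound_nonneg by (intro mult_right_mono) auto
  ultimately show "\<bar>Im x + 2 * Im y\<bar> \<le> M / 10" using defect_bound_nonneg by linarith
qed

end

text \<open>The vortex is invariant under the quarter turn of the lattice combined with multiplication by
  \<open>-\<i>\<close>, which carries \<open>(0, -1)\<close> to \<open>(-1, 0)\<close>. Estimates at one node therefore hold at all.\<close>

lemma rotated_solution:
  assumes "solves \<epsilon> f" "near \<eta> f"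
  shows "solves \<epsilon> (\<lambda>p. - \<i> * f (- snd p, fst p))" "near \<eta> (\<lambda>p. - \<i> * f (- snd p, fst p))"
  by (rule solves_symmetric[OF phase_maps(4) nbr_symmetries(4) assms(1)],
      rule near_symmetric[OF phase_maps(4) _ assms(2)]) (auto simp: vort_def)

lemma parity_defect_rotate:
  "parity_defect (\<lambda>p. - \<i> * f (- snd p, fst p)) p = - \<i> * parity_defect f (- snd p, fst p)"
  by (simp add: parity_defect_def algebra_simps)

lemma defect_node_bound:
  assumes f: "solves \<epsilon> f" "near (1/100) f" and e: "0 < \<epsilon>" "\<epsilon> \<le> 1/10000"
    and M: "\<And>p. cmod (parity_defect f p) \<le> M"
  shows "cmod (parity_defect f (-1, 0)) \<le> M / 2"
proof -
  let ?g = "\<lambda>p. - \<i> * f (- snd p, fst p)"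
  have Mg: "cmod (parity_defect ?g p) \<le> M" for p
    unfolding parity_defect_rotate using M by (simp add: norm_mult)
  note F = defect_node_estimates[OF f e M]
  have "\<bar>Re (parity_defect ?g (-1, 0))\<bar> \<le> M / 20"
    by (rule defect_node_estimates(1)[OF rotated_solution[OF f] e Mg])
  then have "\<bar>Im (parity_defect f (0, -1))\<bar> \<le> M / 20"
    unfolding parity_defect_rotate by simp
  then show ?thesis
    using F cmod_le[of "parity_defect f (-1, 0)"] by linarith
qed

lemma solution_odd:
  assumes f: "solves \<epsilon> f" "near (1/100) f" and e: "0 < \<epsilon>" "\<epsilon> \<le> 1/10000"
  shows "f (- fst p, - snd p) = - f p"
proof -
  have "cmod (parity_defect f p) \<le> M / 2 + 0" if M: "\<And>q. cmod (parity_defect f q) \<le> M" for M p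
  proof (cases "p \<in> nodes")
    case False
    have "5 * \<epsilon> * M \<le> 1/2 * M" using e defect_bound_nonneg[OF f e M] by (intro mult_right_mono) auto
    then show ?thesis using defect_off(1)[OF f e M False] by simp
  next
    case True
    let ?g = "\<lambda>p. - \<i> * f (- snd p, fst p)"
    have Mg: "cmod (parity_defect ?g p) \<le> M" for p
      unfolding parity_defect_rotate using M by (simp add: norm_mult)
    have "cmod (parity_defect ?g (-1, 0)) \<le> M / 2" by (rule defect_node_bound[OF rotated_solution[OF f] e Mg])
    then have "cmod (parity_defect f (0, -1)) \<le> M / 2"
      unfolding parity_defect_rotate by (simp add: norm_mult)
    moreover have "cmod (parity_defect f (-1, 0)) \<le> M / 2" by (rule defect_node_bound[OF f e M])
    moreover have "parity_defect f (1, 0) = parity_defect f (-1, 0)" "parity_defect f (0, 1) = parity_defect f (0, -1)"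
      by (simp_all add: parity_defect_def)
    ultimately show ?thesis using True by (auto simp: nodes_def)
  qed
  moreover have "cmod (parity_defect f p) \<le> 4" for p
    unfolding parity_defect_def using norm_triangle_ineq[of "f p" "f (- fst p, - snd p)"]
      near_norm_le[OF f(2), of p] near_norm_le[OF f(2), of "(- fst p, - snd p)"] by linarith
  ultimately have "cmod (parity_defect f p) \<le> 2 * 0" by (rule self_improving_bound[rotated])
  then show ?thesis by (simp add: parity_defect_def add_eq_0_iff)
qed

section \<open>The relative phase of the two pairs of opposite nodes\<close>

text \<open>The equation satisfied by the even part \<open>P\<close> of a solution under a reflection, \<open>N\<close> being the odd part
  with its phase at a node removed and \<open>w\<close> the square of that phase. For real \<open>w\<close> the equation is
  compatible with real \<open>P\<close> and \<open>N\<close>; the term with \<open>Im w\<close> is the only one in the cubic part that is not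
  proportional to the imaginary parts of \<open>P\<close> and \<open>N\<close>.\<close>

lemma coupled_Im_estimate:
  assumes P: "P = complex_of_real \<epsilon> * L + P * cnj P * P + 2 * (N * cnj N) * P + w * N * N * cnj P"
    and b: "cmod P \<le> \<delta>" "cmod N \<le> \<delta>" "\<bar>Im P\<bar> \<le> F" "\<bar>Im N\<bar> \<le> F" and w: "cmod w \<le> 1"
  shows "\<bar>Im P - \<epsilon> * Im L - Im w * Re (N * N * cnj P)\<bar> \<le> 6 * \<delta>\<^sup>2 * F"
proof -
  have d: "0 \<le> \<delta>" using b(1) norm_ge_zero order_trans by blast
  have rN: "\<bar>Re N\<bar> \<le> \<delta>" "\<bar>Re P\<bar> \<le> \<delta>" "\<bar>Im N\<bar> \<le> \<delta>"
    using abs_Re_le_cmod[of N] abs_Re_le_cmod[of P] abs_Im_le_cmod[of N] b by linarith+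
  have "Im P = \<epsilon> * Im L + (cmod P)\<^sup>2 * Im P + 2 * ((cmod N)\<^sup>2 * Im P) + Re w * Im (N * N * cnj P) + Im w * Re (N * N * cnj P)"
  proof -
    have parts: "Im (P * cnj P * P) = (cmod P)\<^sup>2 * Im P" "Im (2 * (N * cnj N) * P) = 2 * ((cmod N)\<^sup>2 * Im P)"
      by (simp_all only: complex_norm_square[symmetric]) simp_all
    have mixed: "Im (w * N * N * cnj P) = Re w * Im (N * N * cnj P) + Im w * Re (N * N * cnj P)"
      by (simp only: mult.assoc times_complex.simps)
    have lin: "Im (complex_of_real \<epsilon> * L) = \<epsilon> * Im L" by simp
    have "Im P = Im (complex_of_real \<epsilon> * L + P * cnj P * P + 2 * (N * cnj N) * P + w * N * N * cnj P)"
      by (rule arg_cong[OF P])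
    then show ?thesis
      unfolding plus_complex.simps parts mixed lin by (simp only: add.assoc)
  qed
  moreover have "\<bar>(cmod P)\<^sup>2 * Im P\<bar> \<le> \<delta>\<^sup>2 * F" "\<bar>(cmod N)\<^sup>2 * Im P\<bar> \<le> \<delta>\<^sup>2 * F"
    unfolding abs_mult using b by (auto intro!: mult_mono power_mono)
  moreover have "\<bar>Re w * Im (N * N * cnj P)\<bar> \<le> 1 * (3 * \<delta>\<^sup>2 * F)"
    unfolding abs_mult
  proof (intro mult_mono)
    show "\<bar>Re w\<bar> \<le> 1" using abs_Re_le_cmod[of w] w by linarith
    have "Im (N * N * cnj P) = 2 * (Re N * Re P * Im N) - Re N * Re N * Im P + Im N * Im N * Im P"
      by (simp add: algebra_simps)
    moreover have "\<bar>Re N * Re P * Im N\<bar> \<le> \<delta> * \<delta> * F"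
      unfolding abs_mult using rN b d by (intro mult_mono) auto
    moreover have "\<bar>- (Re N * Re N * Im P) + Im N * Im N * Im P\<bar> \<le> \<delta>\<^sup>2 * F"
    proof -
      have "- (Re N * Re N * Im P) + Im N * Im N * Im P = ((Im N)\<^sup>2 - (Re N)\<^sup>2) * Im P"
        by (simp add: power2_eq_square algebra_simps)
      moreover have "\<bar>(Im N)\<^sup>2 - (Re N)\<^sup>2\<bar> \<le> \<delta>\<^sup>2"
        using power_mono[OF rN(1) abs_ge_zero, of 2] power_mono[OF rN(3) abs_ge_zero, of 2]
          zero_le_power2[of "Re N"] zero_le_power2[of "Im N"]
        unfolding power2_abs by linarith
      ultimately show ?thesis using b(3) unfolding abs_mult by (auto simp: abs_mult intro!: mult_mono)
    qed
    ultimately show "\<bar>Im (N * N * cnj P)\<bar> \<le> 3 * \<delta>\<^sup>2 * F"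
      by (simp only: power2_eq_square)
  qed auto
  ultimately show ?thesis by linarith
qed

lemma Re_cubic_near_one:
  assumes "cmod (n - 1) \<le> 1/50" "cmod (p - 1) \<le> 1/50"
  shows "1/2 \<le> Re (n * n * cnj p)"
proof -
  define u v where "u = n - 1" and "v = cnj p - 1"
  have u: "cmod u \<le> 1/50" and v: "cmod v \<le> 1/50"
    using assms complex_mod_cnj[of "p - 1"] by (simp_all add: u_def v_def)
  have "n * n * cnj p - 1 = 2 * u + u * u + (1 + 2 * u + u * u) * v"
    unfolding u_def v_def by (simp add: algebra_simps)
  also have "cmod \<dots> \<le> 2 * (1/50) + 1/50 * (1/50) + (1 + 2 * (1/50) + 1/50 * (1/50)) * (1/50)"
  proof (intro order_trans[OF norm_triangle_ineq] add_mono)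
    have uu: "cmod (u * u) \<le> 1/50 * (1/50)" unfolding norm_mult using u by (intro mult_mono) auto
    then show "cmod (u * u) \<le> 1/50 * (1/50)" .
    show "cmod (2 * u) \<le> 2 * (1/50)" using u by (simp add: norm_mult)
    have "cmod (1 + 2 * u + u * u) \<le> 1 + 2 * (1/50) + 1/50 * (1/50)"
      by (intro order_trans[OF norm_triangle_ineq] add_mono uu) (use u in \<open>auto simp: norm_mult\<close>)
    then show "cmod ((1 + 2 * u + u * u) * v) \<le> (1 + 2 * (1/50) + 1/50 * (1/50)) * (1/50)"
      unfolding norm_mult using v by (intro mult_mono) auto
  qed
  finally have "cmod (n * n * cnj p - 1) \<le> 1/2" by simp
  then show ?thesis using abs_Re_le_cmod[of "n * n * cnj p - 1"] by (simp only: minus_complex.simps one_complex.simps)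
qed

text \<open>Write \<open>f = P + B * N\<close> with \<open>P\<close> even and \<open>B * N\<close> odd under \<open>(n, m) \<mapsto> (n, -m)\<close>, where \<open>B\<close> is the phase
  of \<open>f (0, -1)\<close>. As \<open>f\<close> is odd, \<open>P\<close> and \<open>N\<close> are real at the nodes, and they solve coupled equations whose
  imaginary parts are driven by \<open>w = B\<^sup>2\<close> alone. Hence their imaginary parts are of order \<open>\<epsilon>\<^sup>3 \<sigma>\<close>,
  \<open>\<sigma> = \<bar>Im w\<bar>\<close>. At the corner \<open>(-1, -1)\<close> the driving term equals \<open>\<epsilon>\<^sup>3 Im w\<close> to leading order, whereas
  on the axis \<open>N\<close> vanishes and the imaginary part is one order smaller. The conservation law at
  \<open>(-1, 0)\<close> balances the former against the latter, which forces \<open>\<sigma> = 0\<close>.\<close>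

lemma solution_quadrature:
  assumes f: "solves \<epsilon> f" "near (1/100) f" and e: "0 < \<epsilon>" "\<epsilon> \<le> 1/10000"
    and real: "Im (f (-1, 0)) = 0"
  shows "Re (f (0, -1)) = 0"
proof -
  let ?e = "complex_of_real \<epsilon>"
  have odd: "f (- fst p, - snd p) = - f p" for p by (rule solution_odd[OF f e])
  have odd': "f (-n, -m) = - f (n, m)" for n m using odd[of "(n, m)"] by simp
  define r where "r = (\<lambda>p :: int \<times> int. (fst p, - snd p))"
  define b where "b = f (0, -1)"
  define B where "B = sgn b"
  define P where "P = (\<lambda>p. (f p + f (r p)) / 2)"
  define Q where "Q = (\<lambda>p. (f p - f (r p)) / 2)"
  define N where "N = (\<lambda>p. cnj B * Q p)"
  define w where "w = B * B"
  define \<sigma> where "\<sigma> = \<bar>Im w\<bar>"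
  have b1: "cmod (b - \<i>) \<le> 1/100" using nearD[OF f(2), of "(0, -1)"] by (simp add: b_def vort_def)
  have cb: "\<bar>cmod b - 1\<bar> \<le> 1/100" using b1 norm_triangle_ineq3[of b \<i>] by simp
  then have b0: "b \<noteq> 0" by auto
  have BB: "B * cnj B = 1" using b0 by (simp add: B_def complex_norm_square[symmetric] norm_sgn)
  have nB: "cmod B = 1" using b0 by (simp add: B_def norm_sgn)
  have bB: "b = complex_of_real (cmod b) * B" using b0 by (simp add: B_def sgn_eq)
  have cBb: "cnj B * b = complex_of_real (cmod b)"
    by (subst bB) (use BB in \<open>simp add: mult_ac\<close>)
  have w1: "cmod w \<le> 1" by (simp add: w_def norm_mult nB)
  have QN: "Q p = B * N p" for p unfolding N_def using BB by (simp add: mult.assoc[symmetric])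
  have rr: "r (r p) = p" for p by (simp add: r_def)
  have rn: "r p \<in> nodes \<longleftrightarrow> p \<in> nodes" for p by (cases p) (auto simp: r_def nodes_def)
  have Lr: "nbr_sum f (r p) = nbr_sum (\<lambda>q. f (r q)) p" for p
    using nbr_symmetries(1)[unfolded nbr_symmetry_def, rule_format, of f p] by (simp add: r_def)
  have LP: "nbr_sum P p = (nbr_sum f p + nbr_sum f (r p)) / 2" for p
    unfolding Lr by (cases p) (simp add: P_def nbr_sum_def add_divide_distrib)
  have LN: "nbr_sum N p = cnj B * ((nbr_sum f p - nbr_sum f (r p)) / 2)" for p
    unfolding Lr by (cases p) (simp add: N_def Q_def nbr_sum_def add_divide_distrib diff_divide_distrib algebra_simps)

  have foff: "cmod (f p) \<le> 5 * \<epsilon>" if "p \<notin> nodes" for p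
    using off_node_bound[OF f(2) _ that solvesD[OF f(1)]] e by simp
  have Poff: "cmod (P p) \<le> 5 * \<epsilon>" and Noff: "cmod (N p) \<le> 5 * \<epsilon>" if "p \<notin> nodes" for p
  proof -
    have "cmod (f p) \<le> 5 * \<epsilon>" "cmod (f (r p)) \<le> 5 * \<epsilon>" using that rn foff by auto
    then show "cmod (P p) \<le> 5 * \<epsilon>" "cmod (N p) \<le> 5 * \<epsilon>"
      using norm_triangle_ineq[of "f p" "f (r p)"] norm_triangle_ineq4[of "f p" "f (r p)"]
      by (simp_all add: P_def N_def Q_def norm_mult norm_divide nB)
  qed

  have cubic: "f p = ?e * nbr_sum f p + f p * cnj (f p) * f p" for p
    using solvesD[OF f(1), of p] unfolding complex_norm_square by (simp add: algebra_simps)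
  have fPQ: "f p = P p + Q p" "f (r p) = P p - Q p" for p
    by (simp_all add: P_def Q_def field_simps)
  have QQ: "Q p * cnj (Q p) = N p * cnj (N p)" for p
    unfolding QN using BB by (simp add: mult_ac)
  have Peq: "P p = ?e * nbr_sum P p + P p * cnj (P p) * P p + 2 * (N p * cnj (N p)) * P p + w * N p * N p * cnj (P p)" for p
  proof -
    have "P p = (f p + f (r p)) / 2" by (simp add: P_def)
    also have "\<dots> = (?e * nbr_sum f p + f p * cnj (f p) * f p + (?e * nbr_sum f (r p) + f (r p) * cnj (f (r p)) * f (r p))) / 2"
      by (rule arg_cong2[where f = "\<lambda>x y. (x + y) / 2", OF cubic cubic])
    also have "\<dots> = ?e * nbr_sum P p + (f p * cnj (f p) * f p + f (r p) * cnj (f (r p)) * f (r p)) / 2"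
      unfolding LP by (simp add: field_simps)
    also have "\<dots> = ?e * nbr_sum P p + P p * cnj (P p) * P p + 2 * (Q p * cnj (Q p)) * P p + Q p * Q p * cnj (P p)"
      unfolding fPQ(2)[of p] fPQ(1)[of p] by (simp add: field_simps)
    also have "Q p * Q p * cnj (P p) = w * N p * N p * cnj (P p)"
      unfolding QN w_def by (simp add: mult_ac)
    finally show ?thesis unfolding QQ .
  qed
  have Neq: "N p = ?e * nbr_sum N p + N p * cnj (N p) * N p + 2 * (P p * cnj (P p)) * N p + cnj w * P p * P p * cnj (N p)" for p
  proof -
    have "N p = cnj B * ((f p - f (r p)) / 2)" by (simp add: N_def Q_def)
    also have "\<dots> = cnj B * ((?e * nbr_sum f p + f p * cnj (f p) * f p - (?e * nbr_sum f (r p) + f (r p) * cnj (f (r p)) * f (r p))) / 2)"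
      by (rule arg_cong2[where f = "\<lambda>x y. cnj B * ((x - y) / 2)", OF cubic cubic])
    also have "\<dots> = ?e * nbr_sum N p + cnj B * ((f p * cnj (f p) * f p - f (r p) * cnj (f (r p)) * f (r p)) / 2)"
      unfolding LN by (simp add: field_simps)
    also have "(f p * cnj (f p) * f p - f (r p) * cnj (f (r p)) * f (r p)) / 2 =
        (Q p * cnj (Q p)) * Q p + 2 * (P p * cnj (P p)) * Q p + P p * P p * cnj (Q p)"
      unfolding fPQ(2)[of p] fPQ(1)[of p] by (simp add: field_simps)
    also have "cnj B * \<dots> = (Q p * cnj (Q p)) * (cnj B * Q p) + 2 * (P p * cnj (P p)) * (cnj B * Q p)
        + P p * P p * (cnj B * cnj (Q p))"
      by (simp add: algebra_simps)
    also have "cnj B * Q p = N p" by (simp add: N_def)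
    also have "P p * P p * (cnj B * cnj (Q p)) = cnj w * P p * P p * cnj (N p)"
      unfolding QN w_def by (simp add: mult_ac)
    finally show ?thesis unfolding QQ by (simp only: add.assoc)
  qed

  have Pnode: "Im (P p) = 0" and Nnode: "Im (N p) = 0" if "p \<in> nodes" for p
  proof -
    have "Im (f (1, 0)) = 0" using odd'[of 1 0] real by simp
    moreover have f1: "f (0, 1) = - b" using odd'[of 0 1] by (simp add: b_def)
    ultimately show "Im (P p) = 0"
      using that real by (auto simp: nodes_def P_def r_def b_def[symmetric])
    have "Q (0, -1) = b" "Q (0, 1) = - b" "Q (-1, 0) = 0" "Q (1, 0) = 0"
      using f1 by (simp_all add: Q_def r_def b_def)
    then have "N (0, -1) = complex_of_real (cmod b)" "N (0, 1) = - complex_of_real (cmod b)"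
      "N (-1, 0) = 0" "N (1, 0) = 0"
      using cBb by (simp_all add: N_def)
    then show "Im (N p) = 0" using that by (auto simp: nodes_def)
  qed

  \<comment> \<open>The linear and the diagonal cubic terms only reproduce imaginary parts, with a factor of order \<open>\<epsilon>\<close>.\<close>
  have est: "\<bar>Im (P p) - Im w * Re (N p * N p * cnj (P p))\<bar> \<le> 5 * \<epsilon> * F"
      "\<bar>Im (N p) - Im (cnj w) * Re (P p * P p * cnj (N p))\<bar> \<le> 5 * \<epsilon> * F"
    if F: "\<And>q. max \<bar>Im (P q)\<bar> \<bar>Im (N q)\<bar> \<le> F" and p: "p \<notin> nodes" for p F
  proof -
    have FP: "\<bar>Im (P q)\<bar> \<le> F" and FN: "\<bar>Im (N q)\<bar> \<le> F" for q using F[of q] by auto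
    have F_nonneg: "0 \<le> F" using FP[of p] by linarith
    have ImL: "\<bar>\<epsilon> * Im (nbr_sum h p)\<bar> \<le> \<epsilon> * (4 * F)" if "\<And>q. \<bar>Im (h q)\<bar> \<le> F" for h
    proof -
      obtain n m where p: "p = (n, m)" by (cases p)
      have "\<bar>Im (nbr_sum h p)\<bar> \<le> 4 * F"
        using that[of "(n + 1, m)"] that[of "(n - 1, m)"] that[of "(n, m + 1)"] that[of "(n, m - 1)"]
        unfolding p nbr_sum_def by simp
      then show ?thesis using e by (simp add: abs_mult)
    qed
    have small: "6 * (5 * \<epsilon>)\<^sup>2 * F \<le> \<epsilon> * F"
    proof -
      have "6 * (5 * \<epsilon>)\<^sup>2 * F = (150 * \<epsilon>) * (\<epsilon> * F)" by (simp add: power2_eq_square)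
      also have "\<dots> \<le> 1 * (\<epsilon> * F)" using e F_nonneg by (intro mult_right_mono) auto
      finally show ?thesis by simp
    qed
    show "\<bar>Im (P p) - Im w * Re (N p * N p * cnj (P p))\<bar> \<le> 5 * \<epsilon> * F"
      using coupled_Im_estimate[OF Peq Poff[OF p] Noff[OF p] FP FN w1] ImL[of P, OF FP] small by linarith
    have "cmod (cnj w) \<le> 1" using w1 by simp
    from coupled_Im_estimate[OF Neq Noff[OF p] Poff[OF p] FN FP this] 
    show "\<bar>Im (N p) - Im (cnj w) * Re (P p * P p * cnj (N p))\<bar> \<le> 5 * \<epsilon> * F"
      using ImL[of N, OF FN] small by linarith
  qed

  have ImPN: "max \<bar>Im (P p)\<bar> \<bar>Im (N p)\<bar> \<le> 2 * (125 * \<epsilon> ^ 3 * \<sigma>)" for p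
  proof (rule self_improving_bound[where h = "\<lambda>p. max \<bar>Im (P p)\<bar> \<bar>Im (N p)\<bar>" and ?M0.0 = 4])
    show "max \<bar>Im (P p)\<bar> \<bar>Im (N p)\<bar> \<le> 4" for p
    proof -
      have "cmod (f p) \<le> 101/100" "cmod (f (r p)) \<le> 101/100"
        using near_norm_le[OF f(2), of p] near_norm_le[OF f(2), of "r p"] by auto
      then have "cmod (P p) \<le> 4" "cmod (N p) \<le> 4"
        using norm_triangle_ineq[of "f p" "f (r p)"] norm_triangle_ineq4[of "f p" "f (r p)"]
        by (simp_all add: P_def N_def Q_def norm_mult norm_divide nB)
      then show ?thesis using abs_Im_le_cmod[of "P p"] abs_Im_le_cmod[of "N p"] by simp
    qed
    fix M p assume F: "\<And>q. max \<bar>Im (P q)\<bar> \<bar>Im (N q)\<bar> \<le> M"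
    have M0: "0 \<le> M" using F[of p] by linarith
    have s0: "0 \<le> 125 * \<epsilon> ^ 3 * \<sigma>" using e by (simp add: \<sigma>_def)
    show "max \<bar>Im (P p)\<bar> \<bar>Im (N p)\<bar> \<le> M / 2 + 125 * \<epsilon> ^ 3 * \<sigma>"
    proof (cases "p \<in> nodes")
      case True
      then show ?thesis using Pnode Nnode M0 s0 by simp
    next
      case False
      have R: "\<bar>Re (x * x * cnj y)\<bar> \<le> 125 * \<epsilon> ^ 3" if "cmod x \<le> 5 * \<epsilon>" "cmod y \<le> 5 * \<epsilon>" for x y
      proof -
        have "\<bar>Re (x * x * cnj y)\<bar> \<le> cmod x * cmod x * cmod y"
          using abs_Re_le_cmod[of "x * x * cnj y"] by (simp add: norm_mult)
        also have "\<dots> \<le> 5 * \<epsilon> * (5 * \<epsilon>) * (5 * \<epsilon>)" using that e by (intro mult_mono) auto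
        finally show ?thesis by (simp add: power3_eq_cube)
      qed
      have "\<bar>Im w * Re (N p * N p * cnj (P p))\<bar> \<le> \<sigma> * (125 * \<epsilon> ^ 3)"
        "\<bar>Im (cnj w) * Re (P p * P p * cnj (N p))\<bar> \<le> \<sigma> * (125 * \<epsilon> ^ 3)"
        unfolding abs_mult \<sigma>_def using R Poff[OF False] Noff[OF False]
        by (intro mult_mono; simp)+
      moreover have "5 * \<epsilon> * M \<le> 1/2 * M" using e M0 by (intro mult_right_mono) auto
      ultimately show ?thesis using est[OF F False] by (simp only: mult.commute[of \<sigma>])
    qed
  qed

  \<comment> \<open>The imaginary parts of the neighbours of \<open>(-1, 0)\<close>, whose sum is zero by the equation there.\<close>
  let ?F = "2 * (125 * \<epsilon> ^ 3 * \<sigma>)"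
  have off: "(-1, -1) \<notin> nodes" "(-2, 0) \<notin> nodes" by (auto simp: nodes_def)
  have corner: "\<bar>Im (P (-1, -1)) - Im w * Re (N (-1, -1) * N (-1, -1) * cnj (P (-1, -1)))\<bar> \<le> 5 * \<epsilon> * ?F"
    by (rule est(1)[OF ImPN off(1)])
  have axis: "\<bar>Im (P (-2, 0))\<bar> \<le> 5 * \<epsilon> * ?F"
    using est(1)[OF ImPN off(2)] by (simp add: N_def Q_def r_def)
  have "Im (nbr_sum f (-1, 0)) = 0"
  proof -
    have "Im ((1 - complex_of_real ((cmod (f (-1, 0)))\<^sup>2)) * f (-1, 0)) = 0" using real by simp
    then have "Im (?e * nbr_sum f (-1, 0)) = 0" by (simp only: solvesD[OF f(1), of "(-1, 0)"])
    then show ?thesis using e by simp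
  qed
  moreover have "f (0, 0) = 0" using odd'[of 0 0] by simp
  ultimately have "Im (f (-1, -1)) + Im (f (-1, 1)) + Im (f (-2, 0)) = 0"
    by (simp add: nbr_sum_def)
  moreover have "2 * P (-1, -1) = f (-1, -1) + f (-1, 1)" "P (-2, 0) = f (-2, 0)"
    by (simp_all add: P_def r_def)
  from arg_cong[OF this(1), of Im] arg_cong[OF this(2), of Im]
  have "2 * Im (P (-1, -1)) = Im (f (-1, -1)) + Im (f (-1, 1))" "Im (P (-2, 0)) = Im (f (-2, 0))"
    by simp_all
  ultimately have "2 * Im (P (-1, -1)) + Im (P (-2, 0)) = 0" by linarith
  then have "2 * \<bar>Im w * Re (N (-1, -1) * N (-1, -1) * cnj (P (-1, -1)))\<bar> \<le> 15 * \<epsilon> * ?F"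
    using corner axis by linarith
  moreover have "\<epsilon> ^ 3 / 2 \<le> Re (N (-1, -1) * N (-1, -1) * cnj (P (-1, -1)))"
  proof -
    have res: "cmod (f q - ?e * nbr_sum f q) \<le> \<epsilon>\<^sup>2" if "q \<notin> nodes" for q
      using off_node_residual[OF f _ e(2) that] e by simp
    define a where "a = f (-1, 0)"
    have b2: "f (0, 1) = - b" using odd'[of 0 1] by (simp add: b_def)
    have 1: "cmod (f (-1, -1) - ?e * (a + b)) \<le> \<epsilon>\<^sup>2 + 2 * \<epsilon> * (5 * \<epsilon>)"
      using two_step_nbr_sum(1)[of \<epsilon> f, OF _ res foff] e by (simp add: a_def b_def)
    have 2: "cmod (f (-1, 1) - ?e * (a - b)) \<le> \<epsilon>\<^sup>2 + 2 * \<epsilon> * (5 * \<epsilon>)"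
      using two_step_nbr_sum(2)[of \<epsilon> f, OF _ res foff] e by (simp add: a_def b2)
    define X where "X = f (-1, -1) - ?e * (a + b)"
    define Y where "Y = f (-1, 1) - ?e * (a - b)"
    have XY: "cmod ((X + Y) / 2) \<le> 11 * \<epsilon>\<^sup>2" "cmod ((X - Y) / 2) \<le> 11 * \<epsilon>\<^sup>2"
      using 1 2 norm_triangle_ineq[of X Y] norm_triangle_ineq4[of X Y]
      by (simp_all add: X_def[symmetric] Y_def[symmetric] norm_divide power2_eq_square)
    have P1: "P (-1, -1) = ?e * a + (X + Y) / 2"
      by (simp add: P_def r_def X_def Y_def field_simps)
    have N1: "N (-1, -1) = ?e * complex_of_real (cmod b) + cnj B * ((X - Y) / 2)"
      unfolding cBb[symmetric] by (simp add: N_def Q_def r_def X_def Y_def field_simps)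
    have e0: "?e \<noteq> 0" using e by simp
    have div: "cmod (z / ?e) \<le> 1/100" if "cmod z \<le> 11 * \<epsilon>\<^sup>2" for z
    proof -
      have "11 * \<epsilon>\<^sup>2 = (11 * \<epsilon>) * \<epsilon>" by (simp add: power2_eq_square)
      also have "\<dots> \<le> 1/100 * \<epsilon>" using e by (intro mult_right_mono) auto
      finally show ?thesis using that e by (simp add: norm_divide divide_le_eq)
    qed
    have a1: "cmod (a - 1) \<le> 1/100" using nearD[OF f(2), of "(-1, 0)"] by (simp add: a_def vort_def)
    have "P (-1, -1) / ?e - 1 = (a - 1) + ((X + Y) / 2) / ?e" unfolding P1 using e0 by (simp add: field_simps)
    also have "cmod \<dots> \<le> 1/100 + 1/100" by (intro order_trans[OF norm_triangle_ineq] add_mono a1 div XY)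
    finally have p: "cmod (P (-1, -1) / ?e - 1) \<le> 1/50" by simp
    have "N (-1, -1) / ?e - 1 = complex_of_real (cmod b - 1) + (cnj B * ((X - Y) / 2)) / ?e"
      unfolding N1 using e0 by (simp add: field_simps)
    also have "cmod \<dots> \<le> 1/100 + 1/100"
    proof (intro order_trans[OF norm_triangle_ineq] add_mono div)
      show "cmod (complex_of_real (cmod b - 1)) \<le> 1/100" using cb by (simp only: norm_of_real)
      show "cmod (cnj B * ((X - Y) / 2)) \<le> 11 * \<epsilon>\<^sup>2" using XY(2) by (simp add: norm_mult nB)
    qed
    finally have n: "cmod (N (-1, -1) / ?e - 1) \<le> 1/50" by simp
    have "1/2 \<le> Re ((N (-1, -1) / ?e) * (N (-1, -1) / ?e) * cnj (P (-1, -1) / ?e))"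
      by (rule Re_cubic_near_one[OF n p])
    also have "(N (-1, -1) / ?e) * (N (-1, -1) / ?e) * cnj (P (-1, -1) / ?e)
      = N (-1, -1) * N (-1, -1) * cnj (P (-1, -1)) / complex_of_real (\<epsilon> ^ 3)"
      by (simp add: power3_eq_cube)
    finally have "1/2 \<le> Re (N (-1, -1) * N (-1, -1) * cnj (P (-1, -1))) / \<epsilon> ^ 3"
      by (simp only: Re_divide_of_real)
    then show ?thesis using e by (simp add: le_divide_eq)
  qed
  then have "\<epsilon> ^ 3 / 2 \<le> \<bar>Re (N (-1, -1) * N (-1, -1) * cnj (P (-1, -1)))\<bar>" by linarith
  then have "\<sigma> * (\<epsilon> ^ 3 / 2) \<le> \<bar>Im w * Re (N (-1, -1) * N (-1, -1) * cnj (P (-1, -1)))\<bar>"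
    unfolding abs_mult \<sigma>_def by (rule mult_left_mono) simp
  ultimately have "\<sigma> * \<epsilon> ^ 3 \<le> 15 * \<epsilon> * ?F" by linarith
  also have "\<dots> = (3750 * \<epsilon>) * (\<sigma> * \<epsilon> ^ 3)" by (simp add: mult_ac)
  also have "\<dots> \<le> 1/2 * (\<sigma> * \<epsilon> ^ 3)" using e by (intro mult_right_mono) (auto simp: \<sigma>_def)
  finally have "\<sigma> * \<epsilon> ^ 3 \<le> 0" by simp
  then have "\<sigma> = 0" using e by (simp add: \<sigma>_def mult_le_0_iff)
  then have "Re B * Im B = 0" by (auto simp add: \<sigma>_def w_def)
  moreover have "Im b \<noteq> 0" using b1 abs_Im_le_cmod[of "b - \<i>"] by auto
  moreover have "Re b = cmod b * Re B" "Im b = cmod b * Im B"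
    using arg_cong[OF bB, of Re] arg_cong[OF bB, of Im] by simp_all
  ultimately show ?thesis by (auto simp: b_def)
qed

section \<open>Existence and uniqueness of the continuation\<close>

lemma solution_aligned:
  assumes f: "solves \<epsilon> f" "near (1/100) f" and e: "0 < \<epsilon>" "\<epsilon> \<le> 1/10000"
    and real: "Im (f (-1, 0)) = 0"
  shows "f = entry (vortex \<epsilon>)"
proof (rule proj_solves_unique[OF _ f(2)])
  have "Re (f (0, -1)) = 0" by (rule solution_quadrature[OF f e real])
  moreover have "f (1, 0) = - f (-1, 0)" "f (0, 1) = - f (0, -1)"
    using solution_odd[OF f e, of "(-1, 0)"] solution_odd[OF f e, of "(0, -1)"] by simp_all
  ultimately have "Im (cnj (vort p) * f p) = 0" if "p \<in> nodes" for p
    using that real by (auto simp: nodes_def vort_def)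
  then show "proj_solves \<epsilon> f"
    using solvesD[OF f(1)] unfolding proj_solves_def by simp
  show "proj_solves \<epsilon> (entry (vortex \<epsilon>))" by (rule vortex_proj_solves) (use e in auto)
  show "near (1/100) (entry (vortex \<epsilon>))" by (rule vortex_solves) (use e in auto)
qed (use e in auto)

text \<open>Rotating by the conjugate phase of \<open>\<Psi> (-1, 0)\<close> costs at most twice the distance to the vortex, which is
  why \<open>1/300\<close> is required to land in the neighbourhood of radius \<open>1/100\<close>.\<close>

lemma solution_gauge_equivalent:
  assumes s: "stationary \<epsilon> \<Psi>" and n: "norm (\<Psi> - vortex_limit) \<le> 1/300" and e: "0 < \<epsilon>" "\<epsilon> \<le> 1/10000"
  shows "gauge_equivalent (vortex \<epsilon>) \<Psi>"
proof -
  define g where "g = entry \<Psi>"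
  have g: "solves \<epsilon> g" using s by (simp add: stationary_iff_solves g_def)
  have gn: "cmod (g p - vort p) \<le> 1/300" for p
    using norm_entry_le[of "\<Psi> - vortex_limit" p] n by (simp add: minus_ell2.rep_eq entry_vortex_limit g_def)
  define a where "a = g (-1, 0)"
  have a1: "cmod (a - 1) \<le> 1/300" using gn[of "(-1, 0)"] by (simp add: a_def vort_def)
  have ca: "\<bar>cmod a - 1\<bar> \<le> 1/300" using a1 norm_triangle_ineq3[of a 1] by simp
  have a0: "a \<noteq> 0" using ca by auto
  have us: "cmod (sgn a) = 1" using a0 by (simp add: norm_sgn)
  have "sgn a - a = complex_of_real (1 - cmod a) * sgn a"
    using a0 by (simp add: sgn_eq field_simps)
  then have "cmod (sgn a - a) = \<bar>1 - cmod a\<bar>" using us by (simp only: norm_mult norm_of_real) simp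
  moreover have "cmod (sgn a - 1) \<le> cmod (sgn a - a) + cmod (a - 1)"
    using norm_triangle_ineq[of "sgn a - a" "a - 1"] by simp
  ultimately have u1: "cmod (sgn a - 1) \<le> 2/300" using a1 ca by linarith
  define u where "u = cnj (sgn a)"
  have u: "cmod u = 1" "cmod (u - 1) \<le> 2/300"
    using us u1 complex_mod_cnj[of "sgn a - 1"] by (simp_all add: u_def)
  define f where "f = (\<lambda>p. u * g p)"
  have "solves \<epsilon> f"
    unfolding f_def using solves_symmetric[OF phase_maps(5)[OF u(1)] nbr_symmetries(5) g] .
  moreover have "near (1/100) f" unfolding near_def
  proof
    fix p
    have "f p - vort p = u * (g p - vort p) + (u - 1) * vort p" by (simp add: f_def algebra_simps)
    also have "cmod \<dots> \<le> 1/300 + 2/300"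
      using gn[of p] u norm_vort_le[of p] mult_mono[OF u(2) norm_vort_le[of p]]
      by (intro order_trans[OF norm_triangle_ineq] add_mono) (auto simp: norm_mult)
    finally show "cmod (f p - vort p) \<le> 1/100" by simp
  qed
  moreover have "Im (f (-1, 0)) = 0"
  proof -
    have "u * a = complex_of_real (cmod a) * (sgn a * cnj (sgn a))"
      unfolding u_def using a0 by (subst (2) sgn_eq) (simp add: sgn_eq mult_ac)
    also have "\<dots> = complex_of_real (cmod a)" using us by (simp add: complex_norm_square[symmetric])
    finally show ?thesis by (simp add: f_def a_def[symmetric] del: times_complex.simps)
  qed
  ultimately have fv: "f = entry (vortex \<epsilon>)" using solution_aligned e by blast
  have "entry \<Psi> p = cis (Arg a) * entry (vortex \<epsilon>) p" for p
  proof -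
    have "cis (Arg a) * entry (vortex \<epsilon>) p = (sgn a * cnj (sgn a)) * g p"
      unfolding fv[symmetric] f_def u_def by (simp add: cis_Arg[OF a0] mult_ac)
    also have "\<dots> = g p" using us by (simp add: complex_norm_square[symmetric])
    finally show ?thesis by (simp add: g_def)
  qed
  then show ?thesis unfolding gauge_equivalent_def by blast
qed

lemma vortex_continuation: "is_continuation vortex_limit (1/10000) vortex"
  unfolding is_continuation_def
proof (intro conjI ballI)
  show "stationary \<epsilon> (vortex \<epsilon>)" if "\<epsilon> \<in> {0..<1/10000}" for \<epsilon>
    using that vortex_solves(2)[of \<epsilon>] by (simp add: stationary_iff_solves)
  show "(vortex \<longlongrightarrow> vortex_limit) (at_right 0)"
  proof (rule Lim_null[THEN iffD2], rule Lim_null_comparison)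
    show "\<forall>\<^sub>F \<epsilon> in at_right 0. norm (vortex \<epsilon> - vortex_limit) \<le> 50 * \<epsilon>"
      unfolding eventually_at_right_field by (intro exI[of _ "1/1000"]) (simp add: vortex_near)
    have "((\<lambda>\<epsilon>. 50 * \<epsilon>) \<longlongrightarrow> 50 * 0) (at_right (0::real))" by (intro tendsto_intros)
    then show "((\<lambda>\<epsilon>. 50 * \<epsilon>) \<longlongrightarrow> 0) (at_right (0::real))" by simp
  qed
qed (auto simp: vortex_0)

theorem proposition3p1:
  shows "\<exists>\<epsilon>\<^sub>0 \<Phi>. is_continuation vortex_limit \<epsilon>\<^sub>0 \<Phi> \<and> \<Phi> real_analytic_on {0..<\<epsilon>\<^sub>0} \<and>
    (\<forall>\<epsilon>\<^sub>1 \<Psi>. is_continuation vortex_limit \<epsilon>\<^sub>1 \<Psi> \<longrightarrow>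
      (\<exists>\<delta>>0. \<forall>\<epsilon>\<in>{0..<\<delta>}. gauge_equivalent (\<Phi> \<epsilon>) (\<Psi> \<epsilon>)))"
proof (rule exI[of _ "1/10000"], rule exI[of _ vortex], intro conjI allI impI)
  show "is_continuation vortex_limit (1/10000) vortex" by (rule vortex_continuation)
  show "vortex real_analytic_on {0..<1/10000}"
    by (rule real_analytic_on_subset[OF vortex_real_analytic]) auto
  fix \<epsilon>\<^sub>1 \<Psi> assume \<Psi>: "is_continuation vortex_limit \<epsilon>\<^sub>1 \<Psi>"
  then have "(\<Psi> \<longlongrightarrow> vortex_limit) (at_right 0)" by (simp add: is_continuation_def)
  then have "\<forall>\<^sub>F \<epsilon> in at_right 0. dist (\<Psi> \<epsilon>) vortex_limit < 1/300" by (rule tendstoD) simp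
  then obtain d where d: "0 < d" "\<And>\<epsilon>. 0 < \<epsilon> \<Longrightarrow> \<epsilon> < d \<Longrightarrow> dist (\<Psi> \<epsilon>) vortex_limit < 1/300"
    unfolding eventually_at_right_field by auto
  show "\<exists>\<delta>>0. \<forall>\<epsilon>\<in>{0..<\<delta>}. gauge_equivalent (vortex \<epsilon>) (\<Psi> \<epsilon>)"
  proof (intro exI conjI ballI)
    show "0 < min d (min \<epsilon>\<^sub>1 (1/10000))" using d \<Psi> by (simp add: is_continuation_def)
    fix \<epsilon> assume \<epsilon>: "\<epsilon> \<in> {0..<min d (min \<epsilon>\<^sub>1 (1/10000))}"
    show "gauge_equivalent (vortex \<epsilon>) (\<Psi> \<epsilon>)"
    proof (cases "\<epsilon> = 0")
      case True
      then have "\<Psi> \<epsilon> = vortex \<epsilon>" using \<Psi> by (simp add: is_continuation_def vortex_0)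
      then show ?thesis unfolding gauge_equivalent_def by (intro exI[of _ 0]) simp
    next
      case False
      have "stationary \<epsilon> (\<Psi> \<epsilon>)" using \<Psi> \<epsilon> by (simp add: is_continuation_def)
      moreover have "norm (\<Psi> \<epsilon> - vortex_limit) \<le> 1/300" using d(2)[of \<epsilon>] \<epsilon> False by (simp add: dist_norm)
      ultimately show ?thesis using \<epsilon> False by (intro solution_gauge_equivalent) auto
    qed
  qed
qed

end
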